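(* Let $\delta\in(0,1)$, $\alpha\in(0,\frac12)$, $\tau\in(0,\alpha)$, and $C_\alpha=\frac{1-\alpha}{\sqrt{1-2\alpha}}$. Let $n,K,M$ be positive integers such that $$n\ge\frac{9\log(2/\delta)}{2\tau^2},\qquad K\ge\frac{\log(2/\delta)}{2(\alpha-\tau)^2},\qquad M=\left\lfloor\frac{2n\tau^2}{9\log(2/\delta)}\right\rfloor.$$ Let $X_1,\dots,X_n$ be i.i.d. in a measurable space $\mathcal{Z}$, and let $h:\mathcal{Z}\times\mathcal{Z}\to\mathbb{R}^d$ be a symmetric measurable kernel with $\mathbb{E}\|h(X_1,X_2)\|_2^2<\infty$ and $\Theta(h)=\mathbb{E}[h(X_1,X_2)]\in\mathbb{R}^d$. Let $\widehat\Theta_{\mathrm{MoIU}}(h)$ be the geometric median of $K$ incomplete U-statistics over independent blocks of $M$ pairs, where within each block the pairs are drawn either with replacement or without replacement (as defined in the context). Then, for either of the two within-block sampling schemes, with probability at least $1-\delta$, $$\left\|\widehat\Theta_{\mathrm{MoIU}}(h)-\Theta(h)\right\|_2\le C_\alpha\sqrt{\frac{12\zeta_1^2(h)}{n\tau}+\frac{6\zeta_2^2(h)}{\tau n(n-1)}+\frac{27\zeta^2(h)\log(2/\delta)}{n\tau^3}}.$$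
   Context: Let $\Lambda_n=\{(i,j):1\le i<j\le n\}$. Let $\mathbf{J}_1,\dots,\mathbf{J}_K$ be mutually independent, identically distributed and independent of $(X_1,\dots,X_n)$, each $\mathbf{J}_k$ consisting of $M$ pairs drawn uniformly at random from $\Lambda_n$, in one of two schemes: with replacement ($M$ i.i.d. uniform pairs), or without replacement ($M$ distinct pairs within the block; different blocks may share pairs). Define $\widehat U_{M,\mathbf{J}_k}(h)=\frac1M\sum_{(i,j)\in\mathbf{J}_k}h(X_i,X_j)\in\mathbb{R}^d$ (counted with multiplicity) and let $$\widehat\Theta_{\mathrm{MoIU}}(h)\in\arg\min_{\mathbf{z}\in\mathbb{R}^d}\sum_{k=1}^K\|\mathbf{z}-\widehat U_{M,\mathbf{J}_k}(h)\|_2.$$ Notation: $\zeta_1^2(h)=\mathrm{tr}(\mathrm{Cov}(\mathbb{E}[h(X_1,X_2)\mid X_1]))$, $\zeta^2(h)=\mathrm{tr}(\mathrm{Cov}(h(X_1,X_2)))$, $\zeta_2^2(h)=\zeta^2(h)-2\zeta_1^2(h)$. *)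

theory Defs
  imports "HOL-Probability.Probability"
begin

definition pairs :: "nat \<Rightarrow> (nat \<times> nat) set" where
  "pairs n = {(i, j). 1 \<le> i \<and> i < j \<and> j \<le> n}"

datatype sampling = With_Replacement | Without_Replacement

text \<open>
  A block of \<open>M\<close> pairs is the list of its successive draws, so that pairs are counted with
  multiplicity. Without replacement, the ordered draw is uniform on the lists of \<open>M\<close> distinct
  pairs, hence its underlying set is a uniformly random \<open>M\<close>-subset of \<open>pairs n\<close>.
  These laws are meaningful if \<open>pairs n\<close> is nonempty and, without replacement,
  \<open>M \<le> card (pairs n)\<close>.
\<close>

fun block_pmf :: "sampling \<Rightarrow> nat \<Rightarrow> nat \<Rightarrow> (nat \<times> nat) list pmf" where
  "block_pmf With_Replacement n M = replicate_pmf M (pmf_of_set (pairs n))"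
| "block_pmf Without_Replacement n M =
     pmf_of_set {js. length js = M \<and> distinct js \<and> set js \<subseteq> pairs n}"

definition incomplete_U ::
    "nat \<Rightarrow> ('z \<Rightarrow> 'z \<Rightarrow> real ^ 'd) \<Rightarrow> (nat \<Rightarrow> 'z) \<Rightarrow> (nat \<times> nat) list \<Rightarrow> real ^ 'd" where
  "incomplete_U M h x js = (1 / real M) *\<^sub>R (\<Sum>(i, j)\<leftarrow>js. h (x i) (x j))"

definition is_geometric_median :: "nat \<Rightarrow> (nat \<Rightarrow> real ^ 'd) \<Rightarrow> real ^ 'd \<Rightarrow> bool" where
  "is_geometric_median K u z \<longleftrightarrow> is_arg_min (\<lambda>z. \<Sum>k\<in>{1..K}. norm (z - u k)) (\<lambda>_. True) z"

definition cov_matrix :: "'w measure \<Rightarrow> ('w \<Rightarrow> real ^ 'd) \<Rightarrow> real ^ 'd ^ 'd" where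
  "cov_matrix P Y = (\<chi> i j. integral\<^sup>L P (\<lambda>\<omega>.
     (Y \<omega> $ i - integral\<^sup>L P (\<lambda>\<omega>. Y \<omega> $ i)) * (Y \<omega> $ j - integral\<^sup>L P (\<lambda>\<omega>. Y \<omega> $ j))))"

text \<open>The library's conditional expectation is real-valued, so it is taken componentwise.\<close>

definition vec_cond_exp ::
    "'w measure \<Rightarrow> 'w measure \<Rightarrow> ('w \<Rightarrow> real ^ 'd) \<Rightarrow> 'w \<Rightarrow> real ^ 'd" where
  "vec_cond_exp P F Y = (\<lambda>\<omega>. \<chi> i. real_cond_exp P F (\<lambda>\<omega>. Y \<omega> $ i) \<omega>)"

text \<open>
  In the following, \<open>P\<close> is the probability space, \<open>N\<close> the measurable space of observations,
  and \<open>X 1\<close>, \<open>X 2\<close> the first two observations. The values of \<open>zeta1_sq\<close>, \<open>zeta_sq\<close> and \<open>zeta2_sq\<close>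
  are the squared quantities.
\<close>

definition Theta :: "'w measure \<Rightarrow> (nat \<Rightarrow> 'w \<Rightarrow> 'z) \<Rightarrow> ('z \<Rightarrow> 'z \<Rightarrow> real ^ 'd) \<Rightarrow> real ^ 'd" where
  "Theta P X h = integral\<^sup>L P (\<lambda>\<omega>. h (X 1 \<omega>) (X 2 \<omega>))"

definition zeta1_sq ::
    "'w measure \<Rightarrow> 'z measure \<Rightarrow> (nat \<Rightarrow> 'w \<Rightarrow> 'z) \<Rightarrow> ('z \<Rightarrow> 'z \<Rightarrow> real ^ 'd) \<Rightarrow> real" where
  "zeta1_sq P N X h = trace (cov_matrix P
     (vec_cond_exp P (vimage_algebra (space P) (X 1) N) (\<lambda>\<omega>. h (X 1 \<omega>) (X 2 \<omega>))))"

definition zeta_sq :: "'w measure \<Rightarrow> (nat \<Rightarrow> 'w \<Rightarrow> 'z) \<Rightarrow> ('z \<Rightarrow> 'z \<Rightarrow> real ^ 'd) \<Rightarrow> real" where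
  "zeta_sq P X h = trace (cov_matrix P (\<lambda>\<omega>. h (X 1 \<omega>) (X 2 \<omega>)))"

definition zeta2_sq ::
    "'w measure \<Rightarrow> 'z measure \<Rightarrow> (nat \<Rightarrow> 'w \<Rightarrow> 'z) \<Rightarrow> ('z \<Rightarrow> 'z \<Rightarrow> real ^ 'd) \<Rightarrow> real" where
  "zeta2_sq P N X h = zeta_sq P X h - 2 * zeta1_sq P N X h"

end

theory Submission
  imports Defs
begin

text \<open>
  If fewer than \<open>\<alpha> * K\<close> of the \<open>K\<close> block estimates are farther than \<open>r\<close> from the mean, then moving a
  point at distance more than \<open>C\<^sub>\<alpha> * r\<close> towards the mean strictly decreases the sum of distances, so
  the geometric median lies within \<open>C\<^sub>\<alpha> * r\<close>. It remains to bound the number of bad blocks. Given the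
  sample, the blocks are independent and each is bad with the same probability \<open>p\<close>, a function of the
  sample, so by Hoeffding's inequality the bad fraction exceeds \<open>p\<close> by \<open>\<alpha> - \<tau>\<close> only with probability
  \<open>\<delta> / 2\<close>. A block touches at most \<open>2 * M\<close> observations and the law of a block is invariant under
  relabeling of the sample, so \<open>p\<close> is a U-statistic of order \<open>2 * M\<close>, and it exceeds its expectation
  by \<open>2 * \<tau> / 3\<close> only with probability \<open>\<delta> / 2\<close>. The expectation of \<open>p\<close> is at most \<open>\<tau> / 3\<close> by
  Chebyshev's inequality, because the mean squared error of a block is at most that of the complete
  U-statistic plus \<open>\<zeta>\<^sup>2 / M\<close>.
\<close>

section \<open>Robustness of the geometric median\<close>

text \<open>Different blocks may use the same observations, so their estimates are dependent and
  Hoeffding's inequality does not apply to them directly; freezing the sample puts all of the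
  dependence into the single variable p. Both schemes are uniform on finite sets of lists closed
  under relabeling, so p is a normalized count and statements about blocks become bijections. The
  sample splits into b = n div (2 * M) disjoint windows of 2 * M indices, each able to hold a copy
  of any block, hence the rate exp (- 2 * b * (2 * \<tau> / 3)^2). With L = ln (2 / \<delta>),
  rounding costs n <= 4 * M * b, and M <= 2 * n * \<tau>^2 / (9 * L) then brings this to \<delta> /
  2. Conversely 1 / M <= 9 * L / (n * \<tau>^2), because rounding down at most halves M. Allowing a
  mean of \<tau> / 3 sets r^2 to 3 / \<tau> times the error bound, so the constants of the theorem
  are 12 = 3 * 4, 6 = 3 * 2 and 27 = 3 * 9.\<close>

lemma norm_diff_scaleR_le:
  fixes w a :: "'a::real_inner"
  assumes "w \<noteq> 0"
  shows "norm (w - t *\<^sub>R a) \<le> norm w - t * (a \<bullet> w / norm w) + t\<^sup>2 * ((norm a)\<^sup>2 / (2 * norm w))"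
    (is "_ \<le> ?R")
proof -
  have w: "norm w > 0" using assms by simp
  \<comment> \<open>The AM-GM inequality between the old and the new norm replaces a derivative: it
    gives the first-order expansion along the ray with an explicit quadratic error.\<close>
  have "0 \<le> (norm (w - t *\<^sub>R a) - norm w)\<^sup>2" by simp
  also have "\<dots> = (norm (w - t *\<^sub>R a))\<^sup>2 + (norm w)\<^sup>2 - 2 * norm (w - t *\<^sub>R a) * norm w"
    by (simp add: power2_diff)
  also have "(norm (w - t *\<^sub>R a))\<^sup>2 = (norm w)\<^sup>2 - 2 * t * (a \<bullet> w) + t\<^sup>2 * (norm a)\<^sup>2"
    unfolding power2_norm_eq_inner
    by (simp add: inner_diff_left inner_diff_right inner_commute power2_eq_square algebra_simps)
  finally have "2 * norm (w - t *\<^sub>R a) * norm w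
      \<le> 2 * (norm w)\<^sup>2 - 2 * t * (a \<bullet> w) + t\<^sup>2 * (norm a)\<^sup>2"
    by simp
  also have "\<dots> = 2 * ?R * norm w"
    using w by (simp add: field_simps power2_eq_square)
  finally show ?thesis
    using w by simp
qed

text \<open>Seen from \<open>a\<close>, the ball of radius \<open>r\<close> around 0 fills a cone
  around the direction to its center whose half-angle has cosine sqrt (1 - (r / norm a)^2). This
  exceeds c = \<alpha> / (1 - \<alpha>) once \<open>norm a\<close> is more than 1 / sqrt (1 - c^2)
  times \<open>r\<close>, and that factor is exactly (1 - \<alpha>) / sqrt (1 - 2 *
  \<alpha>).\<close>

lemma inner_gt_of_close:
  fixes a b :: "'a::real_inner"
  assumes "0 < \<alpha>" "\<alpha> < 1 / 2" "norm b \<le> r" "(1 - \<alpha>) / sqrt (1 - 2 * \<alpha>) * r < norm a"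
  shows "a \<noteq> b" "a \<bullet> (a - b) > \<alpha> / (1 - \<alpha>) * norm a * norm (a - b)"
proof -
  define c where "c = \<alpha> / (1 - \<alpha>)"
  define d where "d = norm a"
  define s where "s = a \<bullet> b"
  define q where "q = 1 - 2 * \<alpha>"
  have q: "q > 0" and c: "c > 0" using assms by (auto simp: q_def c_def)
  have r: "r \<ge> 0" using assms(3) norm_ge_zero order_trans by blast
  have cc: "1 - c\<^sup>2 = q / (1 - \<alpha>)\<^sup>2"
  proof -
    have "1 - c\<^sup>2 = ((1 - \<alpha>)\<^sup>2 - \<alpha>\<^sup>2) / (1 - \<alpha>)\<^sup>2"
      using assms by (simp add: c_def power_divide diff_divide_distrib)
    also have "(1 - \<alpha>)\<^sup>2 - \<alpha>\<^sup>2 = q" by (simp add: q_def power2_eq_square algebra_simps)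
    finally show ?thesis .
  qed
  then have c1: "1 - c\<^sup>2 > 0" using q assms by simp
  have "(1 - \<alpha>) * r < d * sqrt q"
    using assms q by (simp add: d_def q_def field_simps)
  then have "((1 - \<alpha>) * r)\<^sup>2 < (d * sqrt q)\<^sup>2"
    by (intro power_strict_mono) (use assms r in auto)
  then have "r\<^sup>2 < (1 - c\<^sup>2) * d\<^sup>2"
    using q assms by (simp add: cc power_mult_distrib pos_less_divide_eq mult.commute)
  moreover have "(norm b)\<^sup>2 \<le> r\<^sup>2" using assms(3) by (intro power_mono) auto
  ultimately have b2: "(norm b)\<^sup>2 < (1 - c\<^sup>2) * d\<^sup>2" by simp
  have dpos: "d > 0"
    using b2 by (metis d_def norm_ge_zero less_eq_real_def mult_zero_right not_less zero_le_power2 zero_power2)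
  have "(1 - c\<^sup>2) * d\<^sup>2 \<le> 1 * d\<^sup>2" by (intro mult_right_mono) auto
  then have bd: "norm b < d" using b2 dpos
    by (smt (verit) norm_ge_zero power_mono)
  then show "a \<noteq> b" by (auto simp: d_def)
  have "s \<le> norm a * norm b" unfolding s_def by (rule norm_cauchy_schwarz)
  also have "\<dots> < d * d" using bd dpos by (simp add: d_def)
  finally have s: "s < d\<^sup>2" by (simp add: power2_eq_square)
  have ab: "a \<bullet> (a - b) = d\<^sup>2 - s"
    by (simp add: d_def s_def inner_diff_right power2_norm_eq_inner)
  have nab: "(norm (a - b))\<^sup>2 = d\<^sup>2 - 2 * s + (norm b)\<^sup>2"
    unfolding d_def s_def power2_norm_eq_inner
    by (simp add: inner_diff_left inner_diff_right inner_commute)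
  \<comment> \<open>Replacing \<open>(norm b)\<^sup>2\<close> by its upper bound (1 - c^2) * d^2
    turns the difference of the two sides of the target inequality into the perfect square ((1 -
    c^2) * d^2 - s)^2.\<close>
  have "c\<^sup>2 * d\<^sup>2 * (norm b)\<^sup>2 < c\<^sup>2 * d\<^sup>2 * ((1 - c\<^sup>2) * d\<^sup>2)"
    using b2 c dpos by simp
  moreover have "0 \<le> ((1 - c\<^sup>2) * d\<^sup>2 - s)\<^sup>2" by simp
  ultimately have "c\<^sup>2 * d\<^sup>2 * (d\<^sup>2 - 2 * s + (norm b)\<^sup>2) < (d\<^sup>2 - s)\<^sup>2"
    by (simp add: power2_eq_square algebra_simps)
  then have "(c * d * norm (a - b))\<^sup>2 < (d\<^sup>2 - s)\<^sup>2"
    by (simp add: power_mult_distrib nab)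
  then have "c * d * norm (a - b) < d\<^sup>2 - s"
    using s by (simp add: power2_less_imp_less)
  then show "a \<bullet> (a - b) > \<alpha> / (1 - \<alpha>) * norm a * norm (a - b)"
    by (simp add: ab c_def d_def)
qed

text \<open>When \<open>z\<close> moves toward \<theta>, a good point lowers the sum at a rate above
  \<alpha> / (1 - \<alpha>) * norm a, and a bad point raises it at a rate of at most norm a. More
  than (1 - \<alpha>) * card I points are good, so the gain exceeds \<alpha> * card I * norm a,
  which is more than the bad points can offset.\<close>

lemma geometric_median_robust:
  fixes u :: "'i \<Rightarrow> 'a::real_inner" and \<alpha> r :: real
  assumes \<alpha>: "0 < \<alpha>" "\<alpha> < 1 / 2" and I: "finite I"
    and min: "\<And>w. (\<Sum>k\<in>I. norm (z - u k)) \<le> (\<Sum>k\<in>I. norm (w - u k))"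
    and bad: "real (card {k\<in>I. norm (u k - \<theta>) > r}) < \<alpha> * card I"
  shows "norm (z - \<theta>) \<le> (1 - \<alpha>) / sqrt (1 - 2 * \<alpha>) * r"
proof (rule ccontr)
  assume "\<not> ?thesis"
  then have far: "(1 - \<alpha>) / sqrt (1 - 2 * \<alpha>) * r < norm (z - \<theta>)" by simp
  define a where "a = z - \<theta>"
  define B where "B = {k\<in>I. norm (u k - \<theta>) > r}"
  define G where "G = I - B"
  have fin: "finite B" "finite G" and GB: "I = G \<union> B" "G \<inter> B = {}"
    using I by (auto simp: B_def G_def)
  have cardI: "real (card I) = card G + card B"
    using GB fin by (simp add: card_Un_disjoint)
  have bad': "card B < \<alpha> * card I" using bad by (simp add: B_def)
  then have cG: "card G > (1 - \<alpha>) * card I" using cardI by (simp add: algebra_simps)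
  have "card I > 0" using bad' \<alpha> by (cases "card I = 0") auto
  then have "(1 - \<alpha>) * card I > 0" using \<alpha> by simp
  then have Gne: "G \<noteq> {}" using cG by force
  have good: "z - u k \<noteq> 0 \<and> a \<bullet> (z - u k) > \<alpha> / (1 - \<alpha>) * norm a * norm (z - u k)"
    if "k \<in> G" for k
  proof -
    have "norm (u k - \<theta>) \<le> r" using that by (auto simp: G_def B_def)
    from inner_gt_of_close[OF \<alpha> this, of a] far show ?thesis
      by (auto simp: a_def)
  qed
  \<comment> \<open>\<open>A\<close> bounds the initial rate of decrease from below;
    \<open>Q\<close> collects the second-order errors of \<open>norm_diff_scaleR_le\<close>.\<close>
  define A where "A = (\<Sum>k\<in>G. a \<bullet> (z - u k) / norm (z - u k)) - card B * norm a"
  define Q where "Q = (\<Sum>k\<in>G. (norm a)\<^sup>2 / (2 * norm (z - u k)))"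
  have "(\<Sum>k\<in>G. \<alpha> / (1 - \<alpha>) * norm a) \<le> (\<Sum>k\<in>G. a \<bullet> (z - u k) / norm (z - u k))"
    using good by (intro sum_mono) (fastforce simp: pos_le_divide_eq)
  then have "A \<ge> (card G * (\<alpha> / (1 - \<alpha>)) - card B) * norm a"
    by (simp add: A_def algebra_simps)
  moreover have "card G * (\<alpha> / (1 - \<alpha>)) > \<alpha> * card I"
  proof -
    have "\<alpha> * card I = (1 - \<alpha>) * card I * (\<alpha> / (1 - \<alpha>))" using \<alpha> by simp
    also have "\<dots> < card G * (\<alpha> / (1 - \<alpha>))"
      using cG \<alpha> by (intro mult_strict_right_mono) auto
    finally show ?thesis .
  qed
  moreover have "norm a > 0" using good Gne by force
  ultimately have A: "A > 0" using bad'
    by (smt (verit) mult_pos_pos)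
  have Q: "Q \<ge> 0" unfolding Q_def by (intro sum_nonneg) auto
  \<comment> \<open>The change of the sum is at most t * (t * Q - A), negative for this
    \<open>t\<close>; the summand 1 covers Q = 0.\<close>
  define t where "t = A / (Q + 1)"
  have t: "t > 0" using A Q by (simp add: t_def)
  have "(\<Sum>k\<in>I. norm ((z - t *\<^sub>R a) - u k))
      = (\<Sum>k\<in>G. norm ((z - u k) - t *\<^sub>R a)) + (\<Sum>k\<in>B. norm ((z - u k) - t *\<^sub>R a))"
    unfolding GB(1) using fin GB by (subst sum.union_disjoint) (auto simp: algebra_simps)
  also have "\<dots> \<le> (\<Sum>k\<in>G. norm (z - u k) - t * (a \<bullet> (z - u k) / norm (z - u k))
        + t\<^sup>2 * ((norm a)\<^sup>2 / (2 * norm (z - u k))))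
      + (\<Sum>k\<in>B. norm (z - u k) + t * norm a)"
  proof (intro add_mono sum_mono)
    fix k assume "k \<in> G"
    then show "norm ((z - u k) - t *\<^sub>R a) \<le> norm (z - u k) - t * (a \<bullet> (z - u k) / norm (z - u k))
        + t\<^sup>2 * ((norm a)\<^sup>2 / (2 * norm (z - u k)))"
      using good by (intro norm_diff_scaleR_le) auto
  next
    fix k
    show "norm ((z - u k) - t *\<^sub>R a) \<le> norm (z - u k) + t * norm a"
      using norm_triangle_ineq4[of "z - u k" "t *\<^sub>R a"] t by simp
  qed
  also have "\<dots> = (\<Sum>k\<in>I. norm (z - u k)) + t * (t * Q - A)"
  proof -
    have "(\<Sum>k\<in>G. norm (z - u k) - t * p k + t\<^sup>2 * q k) + (\<Sum>k\<in>B. norm (z - u k) + t * norm a)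
        = (\<Sum>k\<in>I. norm (z - u k)) + t * (t * (\<Sum>k\<in>G. q k) - ((\<Sum>k\<in>G. p k) - card B * norm a))"
      for p q :: "'i \<Rightarrow> real"
      unfolding GB(1) using fin GB
      by (simp add: sum.union_disjoint sum.distrib sum_subtractf sum_distrib_left[symmetric]
          power2_eq_square algebra_simps)
    then show ?thesis unfolding A_def Q_def .
  qed
  also have "\<dots> < (\<Sum>k\<in>I. norm (z - u k))"
  proof -
    have "t * Q - A = - A / (Q + 1)" using Q by (simp add: t_def field_simps)
    then have "t * Q - A < 0" using A Q by simp
    then show ?thesis using t by (simp add: mult_pos_neg)
  qed
  finally show False using min[of "z - t *\<^sub>R a"] by simp
qed

section \<open>Random blocks of pairs\<close>

text \<open>The complements of \<open>V\<close> and of its image have equal size, so a bijection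
  between them completes \<open>f\<close>. Applied to pairs it moves two draws to prescribed ones;
  applied to sample indices it moves a block into a window.\<close>

lemma inj_on_extends_to_permutes:
  assumes "finite A" "inj_on f V" "V \<subseteq> A" "f ` V \<subseteq> A"
  obtains \<sigma> where "\<sigma> permutes A" "\<And>v. v \<in> V \<Longrightarrow> \<sigma> v = f v"
proof -
  have "card (A - V) = card (A - f ` V)"
    using assms by (simp add: card_Diff_subset finite_subset card_image)
  then obtain g where g: "bij_betw g (A - V) (A - f ` V)"
    using assms(1) by (meson bij_betw_iff_card finite_Diff)
  define \<sigma> where "\<sigma> = (\<lambda>x. if x \<in> V then f x else if x \<in> A then g x else x)"
  have "bij_betw \<sigma> V (f ` V)"
    using assms(2) by (auto simp: \<sigma>_def bij_betw_def inj_on_def)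
  moreover have "bij_betw \<sigma> (A - V) (A - f ` V)"
    using g by (rule bij_betw_cong[THEN iffD1, rotated]) (auto simp: \<sigma>_def)
  ultimately have "bij_betw \<sigma> (V \<union> (A - V)) (f ` V \<union> (A - f ` V))"
    by (rule bij_betw_combine) auto
  moreover have "V \<union> (A - V) = A" "f ` V \<union> (A - f ` V) = A" using assms by auto
  ultimately have "\<sigma> permutes A"
    by (intro bij_imp_permutes) (use assms in \<open>auto simp: \<sigma>_def\<close>)
  then show ?thesis by (rule that) (auto simp: \<sigma>_def)
qed

text \<open>Common support of both schemes. Each block law is uniform on it
  (\<open>block_pmf_eq\<close>), so probabilities over a block become normalized counts.\<close>

definition blocks :: "sampling \<Rightarrow> nat \<Rightarrow> nat \<Rightarrow> (nat \<times> nat) list set" where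
  "blocks s n M = {js. length js = M \<and> set js \<subseteq> pairs n \<and> (s = Without_Replacement \<longrightarrow> distinct js)}"

text \<open>\<open>min\<close> and \<open>max\<close> restore the order demanded by
  \<open>pairs\<close>; a symmetric kernel does not notice the reordering.\<close>

definition relabel :: "(nat \<Rightarrow> nat) \<Rightarrow> nat \<times> nat \<Rightarrow> nat \<times> nat" where
  "relabel \<sigma> e = (min (\<sigma> (fst e)) (\<sigma> (snd e)), max (\<sigma> (fst e)) (\<sigma> (snd e)))"

definition meets :: "nat \<times> nat \<Rightarrow> nat \<times> nat \<Rightarrow> bool" where
  "meets e e' \<longleftrightarrow> {fst e, snd e} \<inter> {fst e', snd e'} \<noteq> {}"

lemma finite_pairs [simp]: "finite (pairs n)"
  by (rule finite_subset[of _ "{1..n} \<times> {1..n}"]) (auto simp: pairs_def)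

lemma card_pairs: "card (pairs n) = n choose 2"
proof (induction n)
  case 0
  have "pairs 0 = {}" by (auto simp: pairs_def)
  then show ?case by simp
next
  case (Suc n)
  have "pairs (Suc n) = pairs n \<union> (\<lambda>i. (i, Suc n)) ` {1..n}"
    by (auto simp: pairs_def le_Suc_eq)
  moreover have "pairs n \<inter> (\<lambda>i. (i, Suc n)) ` {1..n} = {}"
    by (auto simp: pairs_def)
  ultimately show ?case
    using Suc by (simp add: card_Un_disjoint card_image inj_on_def numeral_2_eq_2)
qed

lemma real_card_pairs: "real (card (pairs n)) = real n * (real n - 1) / 2"
  by (cases n) (auto simp: card_pairs choose_two real_of_nat_div algebra_simps)

lemma finite_blocks [simp]: "finite (blocks s n M)"
  by (rule finite_subset[OF _ finite_lists_length_eq[of "pairs n" M]]) (auto simp: blocks_def)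

lemma blocks_nonempty:
  assumes "M \<le> card (pairs n)"
  shows "blocks s n M \<noteq> {}"
proof -
  obtain T where T: "T \<subseteq> pairs n" "card T = M" using assms by (meson obtain_subset_with_card_n)
  then obtain js where "set js = T" "distinct js"
    using finite_distinct_list[of T] finite_subset[of T "pairs n"] by auto
  then have "js \<in> blocks s n M" using T by (auto simp: blocks_def distinct_card)
  then show ?thesis by auto
qed

lemma replicate_pmf_of_set:
  assumes "finite S" "S \<noteq> {}"
  shows "replicate_pmf M (pmf_of_set S) = pmf_of_set {js. length js = M \<and> set js \<subseteq> S}"
proof (rule pmf_eqI)
  fix js
  let ?L = "\<lambda>M. {js. length js = M \<and> set js \<subseteq> S}"
  have fin: "finite (?L M)" for M
    using finite_lists_length_eq[OF assms(1), of M] by (simp add: conj_commute)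
  have card: "card (?L M) = card S ^ M" for M
    using card_lists_length_eq[OF assms(1), of M] by (simp add: conj_commute)
  have ne: "?L M \<noteq> {}" for M
    using card[of M] assms fin[of M] by (metis card_0_eq card.empty power_eq_0_iff)
  have "pmf (replicate_pmf M (pmf_of_set S)) js = indicator (?L M) js / card S ^ M"
  proof (induction M arbitrary: js)
    case 0
    then show ?case by (auto simp: indicator_def)
  next
    case (Suc M)
    have eq: "replicate_pmf (Suc M) (pmf_of_set S)
        = map_pmf (\<lambda>(x, xs). x # xs) (pair_pmf (pmf_of_set S) (replicate_pmf M (pmf_of_set S)))"
      by (simp add: pair_pmf_def map_bind_pmf)
    show ?case
    proof (cases js)
      case Nil
      then have "js \<notin> set_pmf (replicate_pmf (Suc M) (pmf_of_set S))"
        by (auto simp: set_replicate_pmf)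
      then show ?thesis using Nil by (simp add: pmf_eq_0_set_pmf)
    next
      case (Cons x xs)
      have "pmf (replicate_pmf (Suc M) (pmf_of_set S)) js
          = pmf (map_pmf (\<lambda>(x, xs). x # xs) (pair_pmf (pmf_of_set S) (replicate_pmf M (pmf_of_set S))))
            ((\<lambda>(x, xs). x # xs) (x, xs))"
        by (simp only: eq Cons prod.case)
      also have "\<dots> = pmf (pair_pmf (pmf_of_set S) (replicate_pmf M (pmf_of_set S))) (x, xs)"
        by (rule pmf_map_inj') (auto simp: inj_def)
      finally show ?thesis
        using assms Suc[of xs] by (simp add: pmf_pair Cons indicator_def)
    qed
  qed
  then show "pmf (replicate_pmf M (pmf_of_set S)) js = pmf (pmf_of_set (?L M)) js"
    by (simp add: pmf_of_set[OF ne fin] card)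
qed

lemma block_pmf_eq:
  assumes "pairs n \<noteq> {}"
  shows "block_pmf s n M = pmf_of_set (blocks s n M)"
proof (cases s)
  case With_Replacement
  then show ?thesis using assms by (simp add: replicate_pmf_of_set blocks_def)
next
  case Without_Replacement
  then show ?thesis by (simp add: blocks_def conj_ac)
qed

lemma bij_betw_map_blocks:
  assumes "bij_betw \<pi> (pairs n) (pairs n)"
  shows "bij_betw (map \<pi>) (blocks s n M) (blocks s n M)"
proof -
  have inj: "inj_on (map \<pi>) (blocks s n M)"
  proof (rule inj_onI)
    fix xs ys assume "xs \<in> blocks s n M" "ys \<in> blocks s n M" "map \<pi> xs = map \<pi> ys"
    moreover from this have "inj_on \<pi> (set xs \<union> set ys)"
      using assms by (auto simp: blocks_def bij_betw_def intro: inj_on_subset)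
    ultimately show "xs = ys" by (simp add: inj_on_map_eq_map)
  qed
  moreover have "map \<pi> ` blocks s n M \<subseteq> blocks s n M"
    using assms by (fastforce simp: blocks_def bij_betw_def distinct_map intro: inj_on_subset)
  ultimately show ?thesis
    by (simp add: bij_betw_def endo_inj_surj)
qed

lemma bij_betw_relabel:
  assumes "\<sigma> permutes {1..n}"
  shows "bij_betw (relabel \<sigma>) (pairs n) (pairs n)"
proof -
  have inj: "inj \<sigma>" using assms by (rule permutes_inj)
  have img: "\<sigma> i \<in> {1..n}" if "1 \<le> i" "i \<le> n" for i
    using assms that by (metis atLeastAtMost_iff permutes_in_image)
  have "relabel \<sigma> ` pairs n \<subseteq> pairs n"
  proof
    fix e assume "e \<in> relabel \<sigma> ` pairs n"
    then obtain i j where ij: "1 \<le> i" "i < j" "j \<le> n" "e = relabel \<sigma> (i, j)"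
      by (auto simp: pairs_def)
    moreover have "\<sigma> i \<noteq> \<sigma> j" using inj ij by (auto simp: inj_eq)
    ultimately show "e \<in> pairs n"
      using img[of i] img[of j] by (auto simp: pairs_def relabel_def min_def max_def)
  qed
  moreover have "inj_on (relabel \<sigma>) (pairs n)"
  proof (rule inj_onI)
    fix e e' assume e: "e \<in> pairs n" "e' \<in> pairs n" and "relabel \<sigma> e = relabel \<sigma> e'"
    then have "{\<sigma> (fst e), \<sigma> (snd e)} = {\<sigma> (fst e'), \<sigma> (snd e')}"
      by (auto simp: relabel_def min_def max_def split: if_splits)
    then have "\<sigma> ` {fst e, snd e} = \<sigma> ` {fst e', snd e'}" by simp
    then have "{fst e, snd e} = {fst e', snd e'}" by (rule inj_image_eq_iff[OF inj, THEN iffD1])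
    then show "e = e'" using e by (auto simp: pairs_def doubleton_eq_iff)
  qed
  ultimately show ?thesis by (simp add: bij_betw_def endo_inj_surj)
qed

lemma relabel_compose: "relabel \<sigma> (relabel \<rho> e) = relabel (\<sigma> \<circ> \<rho>) e"
  by (auto simp: relabel_def min_def max_def)

text \<open>There are 2 choices for the shared endpoint and n - 2 for the other one; sharing both
  would give \<open>e\<close> back. The count becomes the weight of the projection variance in the
  variance of the complete U-statistic.\<close>

lemma card_pairs_meeting:
  assumes "e \<in> pairs n"
  shows "card {e' \<in> pairs n. e' \<noteq> e \<and> meets e e'} = 2 * (n - 2)"
proof -
  obtain i j where e: "e = (i, j)" and ij: "1 \<le> i" "i < j" "j \<le> n"
    using assms by (auto simp: pairs_def)
  define D where "D = {i, j} \<times> ({1..n} - {i, j})"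
  define g where "g = (\<lambda>(k, l). (min k l, max k l :: nat))"
  have "{e' \<in> pairs n. e' \<noteq> e \<and> meets e e'} = g ` D"
  proof (intro set_eqI iffI)
    fix e' assume e': "e' \<in> {e' \<in> pairs n. e' \<noteq> e \<and> meets e e'}"
    obtain k l where "e' = (k, l)" by fastforce
    with e' have kl: "e' = (k, l)" "1 \<le> k" "k < l" "l \<le> n" "(k, l) \<noteq> (i, j)"
      "k \<in> {i, j} \<or> l \<in> {i, j}"
      by (auto simp: pairs_def e meets_def)
    show "e' \<in> g ` D"
    proof (cases "k \<in> {i, j}")
      case True
      then have "(k, l) \<in> D" using kl ij by (auto simp: D_def)
      then show ?thesis using kl by (force simp: g_def)
    next
      case False
      then have "(l, k) \<in> D" using kl ij by (auto simp: D_def)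
      moreover have "e' = g (l, k)" using kl by (simp add: g_def)
      ultimately show ?thesis by blast
    qed
  next
    fix e' assume "e' \<in> g ` D"
    then obtain k l where "(k, l) \<in> D" and e': "e' = g (k, l)" by auto
    then have kl: "k = i \<or> k = j" "1 \<le> l" "l \<le> n" "l \<noteq> i" "l \<noteq> j" by (auto simp: D_def)
    show "e' \<in> {e' \<in> pairs n. e' \<noteq> e \<and> meets e e'}"
      by (cases "k \<le> l") (use kl ij in \<open>auto simp: g_def e' pairs_def e meets_def min_def max_def\<close>)
  qed
  moreover have "inj_on g D"
    by (auto simp: inj_on_def g_def D_def min_def max_def split: if_splits)
  ultimately have "card {e' \<in> pairs n. e' \<noteq> e \<and> meets e e'} = card D"
    by (simp add: card_image)
  also have "\<dots> = 2 * (n - 2)"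
    using ij unfolding D_def card_cartesian_product by (subst card_Diff_subset) auto
  finally show ?thesis .
qed

text \<open>The maps \<phi> inject every fiber of \<open>g\<close> into every other one, so all
  fibers have one size: in effect \<open>g\<close> sends the uniform law on \<open>B\<close> to the
  uniform law on \<open>T\<close>. The product form avoids division by cardinalities.\<close>

lemma sum_eq_average_of_transitive:
  fixes c :: "'b \<Rightarrow> real"
  assumes "finite B" "finite T" "g ` B \<subseteq> T"
    and trans: "\<And>t t'. t \<in> T \<Longrightarrow> t' \<in> T \<Longrightarrow>
      \<exists>\<phi>. inj_on \<phi> B \<and> \<phi> ` B \<subseteq> B \<and> (\<forall>x\<in>B. g x = t \<longrightarrow> g (\<phi> x) = t')"
  shows "card T * (\<Sum>x\<in>B. c (g x)) = card B * (\<Sum>t\<in>T. c t)"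
proof (cases "T = {}")
  case True
  then show ?thesis using assms by auto
next
  case False
  then obtain t0 where t0: "t0 \<in> T" by auto
  define F where "F t = {x \<in> B. g x = t}" for t
  have fin: "finite (F t)" for t using assms by (simp add: F_def)
  have le: "card (F t) \<le> card (F t')" if "t \<in> T" "t' \<in> T" for t t'
  proof -
    obtain \<phi> where \<phi>: "inj_on \<phi> B" "\<phi> ` B \<subseteq> B" "\<forall>x\<in>B. g x = t \<longrightarrow> g (\<phi> x) = t'"
      using trans[OF \<open>t \<in> T\<close> \<open>t' \<in> T\<close>] by blast
    have "inj_on \<phi> (F t)" using \<phi>(1) by (rule inj_on_subset) (auto simp: F_def)
    moreover have "\<phi> ` F t \<subseteq> F t'" using \<phi> by (auto simp: F_def)
    ultimately show ?thesis using fin by (metis card_inj_on_le)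
  qed
  define q where "q = card (F t0)"
  have q: "card (F t) = q" if "t \<in> T" for t using le t0 that by (simp add: q_def le_antisym)
  have "(\<Sum>x\<in>B. d (g x)) = q * (\<Sum>t\<in>T. d t)" for d :: "'b \<Rightarrow> real"
  proof -
    have "(\<Sum>x\<in>B. d (g x)) = (\<Sum>t\<in>T. \<Sum>x\<in>F t. d (g x))"
      unfolding F_def using assms by (intro sum.group[symmetric]) auto
    also have "\<dots> = (\<Sum>t\<in>T. \<Sum>x\<in>F t. d t)" by (intro sum.cong) (auto simp: F_def)
    also have "\<dots> = q * (\<Sum>t\<in>T. d t)" by (simp add: q sum_distrib_left)
    finally show ?thesis .
  qed
  \<comment> \<open>The constant function 1 gives card B = q * card T, which eliminates
    \<open>q\<close>.\<close>
  from this[of c] this[of "\<lambda>_. 1"] show ?thesis by (simp add: algebra_simps)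
qed

text \<open>Two positions of a uniform block are uniform on all couples of pairs with replacement,
  and on couples of different pairs without. The hypotheses \<open>repl\<close> and
  \<open>norepl\<close> bound the average of \<open>c\<close> over these two sets.\<close>

lemma sum_blocks_two_draws:
  fixes c :: "nat \<times> nat \<Rightarrow> nat \<times> nat \<Rightarrow> real" and v :: real
  assumes ab: "a < M" "b < M" "a \<noteq> b"
    and repl: "(\<Sum>e\<in>pairs n. \<Sum>e'\<in>pairs n. c e e') \<le> real (card (pairs n)) ^ 2 * v"
    and norepl: "(\<Sum>e\<in>pairs n. \<Sum>e'\<in>pairs n - {e}. c e e')
        \<le> real (card (pairs n)) * (real (card (pairs n)) - 1) * v"
  shows "(\<Sum>js\<in>blocks s n M. c (js ! a) (js ! b)) \<le> card (blocks s n M) * v"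
proof -
  let ?S = "pairs n" and ?B = "blocks s n M"
  let ?g = "\<lambda>js. (js ! a, js ! b)"
  have mem: "js ! a \<in> ?S" "js ! b \<in> ?S" if "js \<in> ?B" for js
    using that ab nth_mem[of a js] nth_mem[of b js] unfolding blocks_def by blast+
  have concl: "(\<Sum>js\<in>?B. c (js ! a) (js ! b)) \<le> card ?B * v"
    if T: "finite T" "?g ` ?B \<subseteq> T"
      "\<And>t t'. t \<in> T \<Longrightarrow> t' \<in> T \<Longrightarrow>
        \<exists>\<phi>. inj_on \<phi> ?B \<and> \<phi> ` ?B \<subseteq> ?B \<and> (\<forall>x\<in>?B. ?g x = t \<longrightarrow> ?g (\<phi> x) = t')"
      and v: "(\<Sum>t\<in>T. c (fst t) (snd t)) \<le> card T * v" for T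
  proof (cases "T = {}")
    case True
    then have "?B = {}" using T by auto
    then show ?thesis by simp
  next
    case False
    then have pos: "0 < real (card T)" using T by (simp add: card_gt_0_iff)
    have "card T * (\<Sum>js\<in>?B. c (js ! a) (js ! b)) = card ?B * (\<Sum>t\<in>T. c (fst t) (snd t))"
      using sum_eq_average_of_transitive[OF finite_blocks T, of "\<lambda>t. c (fst t) (snd t)"] by simp
    also have "\<dots> \<le> card ?B * (card T * v)" using v by (intro mult_left_mono) auto
    finally have "card T * (\<Sum>js\<in>?B. c (js ! a) (js ! b)) \<le> card T * (card ?B * v)"
      by (simp add: mult_ac)
    then show ?thesis using pos by simp
  qed
  show ?thesis
  proof (cases s)
    case With_Replacement
    show ?thesis
    proof (rule concl[of "?S \<times> ?S"])
      show "?g ` ?B \<subseteq> ?S \<times> ?S" using mem by auto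
      show "(\<Sum>t\<in>?S \<times> ?S. c (fst t) (snd t)) \<le> card (?S \<times> ?S) * v"
        using repl by (simp add: sum.cartesian_product card_cartesian_product power2_eq_square case_prod_beta)
      fix t t' assume t: "t \<in> ?S \<times> ?S" "t' \<in> ?S \<times> ?S"
      \<comment> \<open>Separate transpositions at the two positions form an involution, so
        injectivity is immediate. They may destroy distinctness; the other scheme therefore applies
        one permutation of the pairs to the whole list.\<close>
      define \<phi> where "\<phi> js = js[a := Transposition.transpose (fst t) (fst t') (js ! a),
        b := Transposition.transpose (snd t) (snd t') (js ! b)]"
        for js
      have "inj_on \<phi> ?B"
        using ab by (intro inj_on_inverseI[of _ \<phi>])
          (auto simp: \<phi>_def blocks_def list_eq_iff_nth_eq nth_list_update)
      moreover have "\<phi> ` ?B \<subseteq> ?B"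
      proof
        fix ys assume "ys \<in> \<phi> ` ?B"
        then obtain js where js: "js \<in> ?B" "ys = \<phi> js" by auto
        have "Transposition.transpose (fst t) (fst t') (js ! a) \<in> ?S" 
          "Transposition.transpose (snd t) (snd t') (js ! b) \<in> ?S"
          using t mem[OF js(1)] by (auto simp: Transposition.transpose_def)
        then have "set ys \<subseteq> ?S" using js
          by (auto simp: \<phi>_def blocks_def dest!: set_update_subset_insert[THEN subsetD])
        then show "ys \<in> ?B" using js With_Replacement by (simp add: blocks_def \<phi>_def)
      qed
      moreover have "\<forall>x\<in>?B. ?g x = t \<longrightarrow> ?g (\<phi> x) = t'"
        using ab by (auto simp: \<phi>_def blocks_def nth_list_update)
      ultimately show "\<exists>\<phi>. inj_on \<phi> ?B \<and> \<phi> ` ?B \<subseteq> ?B \<and> (\<forall>x\<in>?B. ?g x = t \<longrightarrow> ?g (\<phi> x) = t')"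
        by blast
    qed simp
  next
    case Without_Replacement
    let ?T = "Sigma ?S (\<lambda>e. ?S - {e})"
    show ?thesis
    proof (rule concl[of ?T])
      show "?g ` ?B \<subseteq> ?T"
        using mem ab Without_Replacement by (auto simp: blocks_def nth_eq_iff_index_eq)
      have "card ?T = (\<Sum>e\<in>?S. card ?S - 1)" by (subst card_SigmaI) auto
      then have cT: "real (card ?T) = real (card ?S) * (real (card ?S) - 1)"
        by (cases "card ?S") (auto simp: algebra_simps)
      show "(\<Sum>t\<in>?T. c (fst t) (snd t)) \<le> card ?T * v"
        unfolding cT using norepl by (simp add: sum.Sigma case_prod_beta)
      fix t t' assume t: "t \<in> ?T" "t' \<in> ?T"
      define f where "f = (\<lambda>e. if e = fst t then fst t' else snd t')"
      obtain \<sigma> where \<sigma>: "\<sigma> permutes ?S" "\<And>e. e \<in> {fst t, snd t} \<Longrightarrow> \<sigma> e = f e"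
        by (rule inj_on_extends_to_permutes[of ?S f "{fst t, snd t}"])
          (use t in \<open>auto simp: inj_on_def f_def\<close>)
      have "bij_betw (map \<sigma>) ?B ?B" by (intro bij_betw_map_blocks permutes_imp_bij \<sigma>)
      moreover have "?g (map \<sigma> js) = t'" if "js \<in> ?B" "?g js = t" for js
      proof -
        have "?g (map \<sigma> js) = (\<sigma> (js ! a), \<sigma> (js ! b))" using that ab by (auto simp: blocks_def)
        also have "\<dots> = (\<sigma> (fst t), \<sigma> (snd t))" using that by auto
        also have "\<dots> = t'" using \<sigma>(2) t by (auto simp: f_def)
        finally show ?thesis .
      qed
      ultimately show "\<exists>\<phi>. inj_on \<phi> ?B \<and> \<phi> ` ?B \<subseteq> ?B \<and> (\<forall>x\<in>?B. ?g x = t \<longrightarrow> ?g (\<phi> x) = t')"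
        by (auto simp: bij_betw_def intro!: exI[of _ "map \<sigma>"])
    qed simp
  qed
qed

text \<open>\<open>v\<close> is the variance of the complete U-statistic, the average of
  \<open>c\<close> over all couples of pairs. Equal positions contribute \<open>z\<close>. Different
  positions average to \<open>v\<close> with replacement and to at most \<open>v\<close> without,
  since the omitted diagonal entries \<open>z\<close> are at least \<open>v\<close>.\<close>

lemma sum_blocks_covariance:
  fixes z z1 :: real and n :: nat and c :: "nat \<times> nat \<Rightarrow> nat \<times> nat \<Rightarrow> real"
  defines "v \<equiv> 4 * z1 / n + 2 * (z - 2 * z1) / (real n * (real n - 1))"
  assumes n: "n \<ge> 2" and z: "0 \<le> z1" "z1 \<le> z"
    and c: "\<And>e e'. e \<in> pairs n \<Longrightarrow> e' \<in> pairs n \<Longrightarrow>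
      c e e' = (if e' = e then z else if meets e e' then z1 else 0)"
  shows "(\<Sum>js\<in>blocks s n M. \<Sum>a<M. \<Sum>b<M. c (js ! a) (js ! b))
    \<le> card (blocks s n M) * (M * z + (real M)\<^sup>2 * v)"
proof -
  let ?S = "pairs n" and ?B = "blocks s n M"
  define p where "p = real (card ?S)"
  have p: "p = real n * (real n - 1) / 2" by (simp add: p_def real_card_pairs)
  have p1: "p \<ge> 1" using n mult_mono[of 2 "real n" 1 "real n - 1"] by (simp add: p)
  \<comment> \<open>A row sum of \<open>c\<close>: the diagonal entry and 2 * (n - 2) meeting
    pairs.\<close>
  have pv: "p * v = z + 2 * (real n - 2) * z1"
    using n by (simp add: v_def p field_simps)
  have v: "v \<ge> 0"
  proof -
    have "p * v \<ge> 0" using n z by (simp add: pv)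
    then show ?thesis using p1 by (simp add: zero_le_mult_iff)
  qed
  have off: "(\<Sum>e'\<in>?S - {e}. c e e') = 2 * (real n - 2) * z1" if "e \<in> ?S" for e
  proof -
    have "(\<Sum>e'\<in>?S - {e}. c e e') = (\<Sum>e'\<in>?S - {e}. if meets e e' then z1 else 0)"
      using that c by (intro sum.cong) auto
    also have "\<dots> = (\<Sum>e'\<in>{e' \<in> ?S - {e}. meets e e'}. z1)"
      by (rule sum.inter_filter[symmetric]) auto
    also have "{e' \<in> ?S - {e}. meets e e'} = {e' \<in> ?S. e' \<noteq> e \<and> meets e e'}" by auto
    finally show ?thesis using card_pairs_meeting[OF that] n by (simp add: of_nat_diff)
  qed
  have all: "(\<Sum>e'\<in>?S. c e e') = z + 2 * (real n - 2) * z1" if "e \<in> ?S" for e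
    using off[OF that] that c[OF that that] by (simp add: sum.remove)
  have repl: "(\<Sum>e\<in>?S. \<Sum>e'\<in>?S. c e e') \<le> real (card ?S) ^ 2 * v"
  proof -
    have "(\<Sum>e\<in>?S. \<Sum>e'\<in>?S. c e e') = (\<Sum>e\<in>?S. p * v)"
      using all pv by (intro sum.cong) auto
    then show ?thesis by (simp add: p_def power2_eq_square mult.assoc)
  qed
  have "v \<le> z"
  proof -
    \<comment> \<open>The 1 + 2 * (n - 2) pairs that equal or meet a fixed pair are at most all
      \<open>p\<close> pairs; in terms of n this is (n - 2) * (n - 3) >= 0.\<close>
    have "real n * real n + 6 \<ge> 5 * real n"
    proof -
      have "(real n - 2) * (real n - 3) \<ge> 0"
        using n by (cases "n = 2") auto
      then show ?thesis by (simp add: algebra_simps)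
    qed
    then have le: "1 + 2 * (real n - 2) \<le> p" by (simp add: p algebra_simps)
    have "p * v \<le> z + 2 * (real n - 2) * z"
      unfolding pv using n z by (intro add_left_mono mult_left_mono) auto
    also have "\<dots> = (1 + 2 * (real n - 2)) * z" by (simp add: algebra_simps)
    also have "\<dots> \<le> p * z" using z le by (intro mult_right_mono) auto
    finally show ?thesis using p1 by simp
  qed
  then have "2 * (real n - 2) * z1 \<le> (p - 1) * v"
    using pv by (simp add: algebra_simps)
  then have "p * (2 * (real n - 2) * z1) \<le> p * ((p - 1) * v)"
    using p1 by (intro mult_left_mono) auto
  then have norepl: "(\<Sum>e\<in>?S. \<Sum>e'\<in>?S - {e}. c e e') \<le> real (card ?S) * (real (card ?S) - 1) * v"
    using off by (simp add: p_def mult.assoc)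
  have "(\<Sum>js\<in>?B. \<Sum>a<M. \<Sum>b<M. c (js ! a) (js ! b)) = (\<Sum>a<M. \<Sum>b<M. \<Sum>js\<in>?B. c (js ! a) (js ! b))"
    by (subst sum.swap) (simp add: sum.swap[of _ _ ?B])
  \<comment> \<open>Diagonal terms are granted a surplus \<open>v\<close>, which rounds M * (M - 1)
    copies of \<open>v\<close> up to M^2.\<close>
  also have "\<dots> \<le> (\<Sum>a<M. \<Sum>b<M. card ?B * ((if b = a then z else 0) + v))"
  proof (intro sum_mono)
    fix a b assume ab: "a \<in> {..<M}" "b \<in> {..<M}"
    show "(\<Sum>js\<in>?B. c (js ! a) (js ! b)) \<le> card ?B * ((if b = a then z else 0) + v)"
    proof (cases "b = a")
      case True
      have "(\<Sum>js\<in>?B. c (js ! a) (js ! b)) = (\<Sum>js\<in>?B. z)"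
      proof (intro sum.cong refl)
        fix js assume "js \<in> ?B"
        then have "js ! a \<in> ?S" using ab nth_mem[of a js] unfolding blocks_def by blast
        then show "c (js ! a) (js ! b) = z" using c True by simp
      qed
      then show ?thesis using True v by (simp add: mult_left_mono)
    next
      case False
      then show ?thesis using sum_blocks_two_draws[of a M b c n v s] repl norepl ab by simp
    qed
  qed
  also have "\<dots> = card ?B * (M * z + (real M)\<^sup>2 * v)"
  proof -
    have "(\<Sum>b<M. card ?B * ((if b = a then z else 0) + v)) = card ?B * (z + M * v)" if "a < M" for a
      unfolding sum_distrib_left[symmetric] sum.distrib using that by simp
    then have "(\<Sum>a<M. \<Sum>b<M. card ?B * ((if b = a then z else 0) + v))
        = (\<Sum>a<M. card ?B * (z + M * v))"
      by (intro sum.cong) auto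
    then show ?thesis by (simp add: power2_eq_square algebra_simps)
  qed
  finally show ?thesis .
qed

section \<open>Covariances of a symmetric kernel\<close>

lemma integrable_mult_of_squares:
  fixes u v :: "'a \<Rightarrow> real"
  assumes "u \<in> borel_measurable M" "v \<in> borel_measurable M"
    and "integrable M (\<lambda>x. (u x)\<^sup>2)" "integrable M (\<lambda>x. (v x)\<^sup>2)"
  shows "integrable M (\<lambda>x. u x * v x)"
proof (rule Bochner_Integration.integrable_bound)
  show "integrable M (\<lambda>x. (u x)\<^sup>2 + (v x)\<^sup>2)" using assms by simp
  show "AE x in M. norm (u x * v x) \<le> norm ((u x)\<^sup>2 + (v x)\<^sup>2)"
  proof (intro AE_I2)
    fix x
    have "0 \<le> (\<bar>u x\<bar> - \<bar>v x\<bar>)\<^sup>2" by simp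
    then have "2 * (\<bar>u x\<bar> * \<bar>v x\<bar>) \<le> (u x)\<^sup>2 + (v x)\<^sup>2"
      by (simp add: power2_diff)
    moreover have "0 \<le> \<bar>u x\<bar> * \<bar>v x\<bar>" by simp
    ultimately show "norm (u x * v x) \<le> norm ((u x)\<^sup>2 + (v x)\<^sup>2)"
      by (simp only: real_norm_def abs_mult abs_of_nonneg[of "(u x)\<^sup>2 + (v x)\<^sup>2"]
          zero_le_power2 add_nonneg_nonneg)
  qed
qed (use assms in simp)

context prob_space
begin

section \<open>Independence and joint laws of coordinates in a product space\<close>

lemma indep_vars_coordinates:
  assumes "I \<noteq> {}"
  shows "prob_space.indep_vars (PiM I (\<lambda>_. M)) (\<lambda>_. M) (\<lambda>i x. x i) I"
proof -
  interpret PX: prob_space "PiM I (\<lambda>_. M)" by (intro prob_space_PiM prob_space_axioms)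
  have "distr (PiM I (\<lambda>_. M)) (PiM I (\<lambda>_. M)) (\<lambda>x. \<lambda>i\<in>I. x i) = distr (PiM I (\<lambda>_. M)) (PiM I (\<lambda>_. M)) (\<lambda>x. x)"
    by (intro distr_cong) (auto simp: space_PiM)
  also have "\<dots> = PiM I (\<lambda>i. distr (PiM I (\<lambda>_. M)) M (\<lambda>x. x i))"
    unfolding distr_id by (intro PiM_cong refl distr_PiM_component[symmetric] prob_space_axioms)
  finally show ?thesis
    using assms by (subst PX.indep_vars_iff_distr_eq_PiM') auto
qed

lemma indep_var_disjoint_coordinates:
  assumes "A \<inter> B = {}" "A \<subseteq> I" "B \<subseteq> I" "I \<noteq> {}"
    and "F \<in> measurable (PiM A (\<lambda>_. M)) S" "G \<in> measurable (PiM B (\<lambda>_. M)) T"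
  shows "prob_space.indep_var (PiM I (\<lambda>_. M)) S (\<lambda>x. F (restrict x A)) T (\<lambda>x. G (restrict x B))"
proof -
  interpret PX: prob_space "PiM I (\<lambda>_. M)" by (intro prob_space_PiM prob_space_axioms)
  show ?thesis
    using PX.indep_var_compose[OF PX.indep_var_restrict[OF indep_vars_coordinates] assms(5,6)] assms(1-4)
    by (simp add: comp_def)
qed

lemma distr_PiM_two_coordinates:
  assumes "i \<in> I" "j \<in> I" "i \<noteq> j"
  shows "distr (PiM I (\<lambda>_. M)) (M \<Otimes>\<^sub>M M) (\<lambda>x. (x i, x j)) = M \<Otimes>\<^sub>M M"
proof -
  interpret PX: prob_space "PiM I (\<lambda>_. M)" by (intro prob_space_PiM prob_space_axioms)
  have "PX.indep_var M (\<lambda>x. (\<lambda>x. x i) (restrict x {i})) M (\<lambda>x. (\<lambda>x. x j) (restrict x {j}))"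
    by (rule indep_var_disjoint_coordinates) (use assms in auto)
  then have "PX.indep_var M (\<lambda>x. x i) M (\<lambda>x. x j)" by simp
  moreover have "distr (PiM I (\<lambda>_. M)) M (\<lambda>x. x k) = M" if "k \<in> I" for k
    by (rule distr_PiM_component[of I "\<lambda>_. M"]) (use that prob_space_axioms in auto)
  ultimately show ?thesis
    using assms by (simp add: PX.indep_var_distribution_eq)
qed

lemma distr_PiM_three_coordinates:
  assumes "i \<in> I" "j \<in> I" "k \<in> I" "i \<noteq> j" "k \<noteq> i" "k \<noteq> j"
  shows "distr (PiM I (\<lambda>_. M)) ((M \<Otimes>\<^sub>M M) \<Otimes>\<^sub>M M) (\<lambda>x. ((x i, x j), x k)) = (M \<Otimes>\<^sub>M M) \<Otimes>\<^sub>M M"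
proof -
  interpret PX: prob_space "PiM I (\<lambda>_. M)" by (intro prob_space_PiM prob_space_axioms)
  let ?A = "PiM {i, j} (\<lambda>_. M)" and ?B = "PiM {k} (\<lambda>_. M)"
  let ?r = "\<lambda>A x. restrict x A"
  let ?F = "\<lambda>x. (x i, x j)" and ?G = "\<lambda>x. x k"
  have r [measurable]: "?r A \<in> measurable (PiM I (\<lambda>_. M)) (PiM A (\<lambda>_. M))" if "A \<subseteq> I" for A
    using that by (intro measurable_restrict_subset) auto
  have F [measurable]: "?F \<in> measurable ?A (M \<Otimes>\<^sub>M M)" and G [measurable]: "?G \<in> measurable ?B M"
    by measurable
  have sub: "{i, j} \<subseteq> I" "{k} \<subseteq> I" using assms by auto
  have FA: "distr (distr (PiM I (\<lambda>_. M)) ?A (?r {i, j})) (M \<Otimes>\<^sub>M M) ?F = M \<Otimes>\<^sub>M M"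
    using assms r[OF sub(1)] by (subst distr_distr) (auto simp: comp_def distr_PiM_two_coordinates)
  have "distr (PiM I (\<lambda>_. M)) M (\<lambda>x. x k) = M"
    by (rule distr_PiM_component[of I "\<lambda>_. M"]) (use assms prob_space_axioms in auto)
  then have GB: "distr (distr (PiM I (\<lambda>_. M)) ?B (?r {k})) M ?G = M"
    using assms r[OF sub(2)] by (subst distr_distr) (auto simp: comp_def)
  have "PX.indep_var ?A (?r {i, j}) ?B (?r {k})"
    by (rule PX.indep_var_restrict[OF indep_vars_coordinates]) (use assms in auto)
  then have J: "distr (PiM I (\<lambda>_. M)) ?A (?r {i, j}) \<Otimes>\<^sub>M distr (PiM I (\<lambda>_. M)) ?B (?r {k})
      = distr (PiM I (\<lambda>_. M)) (?A \<Otimes>\<^sub>M ?B) (\<lambda>x. (?r {i, j} x, ?r {k} x))"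
    by (simp add: PX.indep_var_distribution_eq)
  have "(M \<Otimes>\<^sub>M M) \<Otimes>\<^sub>M M = distr (distr (PiM I (\<lambda>_. M)) ?A (?r {i, j}) \<Otimes>\<^sub>M distr (PiM I (\<lambda>_. M)) ?B (?r {k}))
      ((M \<Otimes>\<^sub>M M) \<Otimes>\<^sub>M M) (\<lambda>(x, y). (?F x, ?G y))"
    using pair_measure_distr[of ?F "distr (PiM I (\<lambda>_. M)) ?A (?r {i, j})" "M \<Otimes>\<^sub>M M"
        ?G "distr (PiM I (\<lambda>_. M)) ?B (?r {k})" M]
    unfolding FA GB by (simp add: prob_space_imp_sigma_finite prob_space_axioms)
  also have "\<dots> = distr (PiM I (\<lambda>_. M)) ((M \<Otimes>\<^sub>M M) \<Otimes>\<^sub>M M) (\<lambda>x. ((x i, x j), x k))"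
    unfolding J using r[OF sub(1)] r[OF sub(2)] by (subst distr_distr) (auto simp: comp_def)
  finally show ?thesis ..
qed

section \<open>Second moments of a real kernel evaluated at two coordinates\<close>

context
  fixes f :: "'a \<Rightarrow> 'a \<Rightarrow> real"
  assumes f_meas: "(\<lambda>(x, y). f x y) \<in> borel_measurable (M \<Otimes>\<^sub>M M)"
    and f_sq: "integrable (M \<Otimes>\<^sub>M M) (\<lambda>(x, y). (f x y)\<^sup>2)"
begin

interpretation MM: pair_prob_space M M ..

lemma integral_kernel_coordinates:
  assumes "i \<in> I" "j \<in> I" "i \<noteq> j"
  shows "(\<lambda>x. f (x i) (x j)) \<in> borel_measurable (PiM I (\<lambda>_. M))"
    and "integrable (PiM I (\<lambda>_. M)) (\<lambda>x. (f (x i) (x j))\<^sup>2)"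
    and "(\<integral>x. (f (x i) (x j))\<^sup>2 \<partial>PiM I (\<lambda>_. M)) = (\<integral>(x, y). (f x y)\<^sup>2 \<partial>(M \<Otimes>\<^sub>M M))"
    and "(\<integral>x. f (x i) (x j) \<partial>PiM I (\<lambda>_. M)) = (\<integral>(x, y). f x y \<partial>(M \<Otimes>\<^sub>M M))"
proof -
  have m [measurable]: "(\<lambda>x. (x i, x j)) \<in> measurable (PiM I (\<lambda>_. M)) (M \<Otimes>\<^sub>M M)"
    using assms by measurable
  note law = distr_PiM_two_coordinates[OF assms]
  have f2 [measurable]: "(\<lambda>(x, y). (f x y)\<^sup>2) \<in> borel_measurable (M \<Otimes>\<^sub>M M)"
    using borel_measurable_power[OF f_meas, of 2] by (simp add: case_prod_beta')
  show "(\<lambda>x. f (x i) (x j)) \<in> borel_measurable (PiM I (\<lambda>_. M))"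
    using measurable_compose[OF m f_meas] by simp
  show "integrable (PiM I (\<lambda>_. M)) (\<lambda>x. (f (x i) (x j))\<^sup>2)"
    using integrable_distr[OF m, of "\<lambda>(x, y). (f x y)\<^sup>2"] f_sq by (simp add: law)
  show "(\<integral>x. (f (x i) (x j))\<^sup>2 \<partial>PiM I (\<lambda>_. M)) = (\<integral>(x, y). (f x y)\<^sup>2 \<partial>(M \<Otimes>\<^sub>M M))"
    by (subst law[symmetric], subst integral_distr) auto
  show "(\<integral>x. f (x i) (x j) \<partial>PiM I (\<lambda>_. M)) = (\<integral>(x, y). f x y \<partial>(M \<Otimes>\<^sub>M M))"
    using f_meas by (subst law[symmetric], subst integral_distr) auto
qed

text \<open>Given the shared coordinate the other two are independent, so Fubini leaves the square
  of the projection. The last three claims record the intermediate facts on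
  \<open>M \<Otimes>\<^sub>M M\<close> and \<open>M\<close> for
  \<open>kernel_projection_le\<close>.\<close>

lemma integral_kernel_shared_coordinate:
  assumes "i \<in> I" "j \<in> I" "k \<in> I" "i \<noteq> j" "k \<noteq> i" "k \<noteq> j"
  shows "(\<integral>x. f (x i) (x j) * f (x i) (x k) \<partial>PiM I (\<lambda>_. M)) = (\<integral>x. (\<integral>y. f x y \<partial>M)\<^sup>2 \<partial>M)"
    and "integrable (M \<Otimes>\<^sub>M M) (\<lambda>(x, y). f x y * (\<integral>y. f x y \<partial>M))"
    and "(\<integral>(x, y). f x y * (\<integral>y. f x y \<partial>M) \<partial>(M \<Otimes>\<^sub>M M)) = (\<integral>x. (\<integral>y. f x y \<partial>M)\<^sup>2 \<partial>M)"
    and "integrable M (\<lambda>x. (\<integral>y. f x y \<partial>M)\<^sup>2)"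
proof -
  interpret trip: pair_prob_space "M \<Otimes>\<^sub>M M" M ..
  note [measurable] = f_meas
  let ?F = "\<lambda>((x, y), w). f x y * f x w"
  have m [measurable]: "(\<lambda>x. ((x i, x j), x k)) \<in> measurable (PiM I (\<lambda>_. M)) ((M \<Otimes>\<^sub>M M) \<Otimes>\<^sub>M M)"
    using assms by measurable
  have "(\<lambda>p. (\<lambda>(x, y). f x y) (fst p) * (\<lambda>(x, y). f x y) (fst (fst p), snd p))
      \<in> borel_measurable ((M \<Otimes>\<^sub>M M) \<Otimes>\<^sub>M M)"
    by (intro borel_measurable_times measurable_compose[OF _ f_meas]) measurable
  then have F [measurable]: "?F \<in> borel_measurable ((M \<Otimes>\<^sub>M M) \<Otimes>\<^sub>M M)"
    by (simp add: case_prod_beta')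
  note law = distr_PiM_three_coordinates[OF assms]
  \<comment> \<open>Integrability on the triple product is inherited from the coordinate space,
    where the integrand is a product of two square-integrable functions.\<close>
  have "integrable (PiM I (\<lambda>_. M)) (\<lambda>x. f (x i) (x j) * f (x i) (x k))"
    using assms by (intro integrable_mult_of_squares integral_kernel_coordinates) auto
  then have "integrable (distr (PiM I (\<lambda>_. M)) ((M \<Otimes>\<^sub>M M) \<Otimes>\<^sub>M M) (\<lambda>x. ((x i, x j), x k))) ?F"
    by (subst integrable_distr_eq[OF m F]) simp
  then have int: "integrable ((M \<Otimes>\<^sub>M M) \<Otimes>\<^sub>M M) ?F"
    unfolding law .
  have eq: "(\<lambda>p. \<integral>w. ?F (p, w) \<partial>M) = (\<lambda>(x, y). f x y * (\<integral>y. f x y \<partial>M))"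
    by (auto simp: fun_eq_iff)
  have eq2: "(\<lambda>x. \<integral>y. (\<lambda>(x, y). f x y * (\<integral>y. f x y \<partial>M)) (x, y) \<partial>M) = (\<lambda>x. (\<integral>y. f x y \<partial>M)\<^sup>2)"
    by (auto simp: fun_eq_iff power2_eq_square)
  show int2: "integrable (M \<Otimes>\<^sub>M M) (\<lambda>(x, y). f x y * (\<integral>y. f x y \<partial>M))"
    using trip.integrable_fst'[OF int] unfolding eq .
  show "integrable M (\<lambda>x. (\<integral>y. f x y \<partial>M)\<^sup>2)"
    using MM.integrable_fst'[OF int2] unfolding eq2 .
  show fub: "(\<integral>(x, y). f x y * (\<integral>y. f x y \<partial>M) \<partial>(M \<Otimes>\<^sub>M M)) = (\<integral>x. (\<integral>y. f x y \<partial>M)\<^sup>2 \<partial>M)"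
    using MM.integral_fst'[OF int2] unfolding eq2 by simp
  have "(\<integral>x. f (x i) (x j) * f (x i) (x k) \<partial>PiM I (\<lambda>_. M)) = integral\<^sup>L ((M \<Otimes>\<^sub>M M) \<Otimes>\<^sub>M M) ?F"
    using integral_distr[OF m F] unfolding law by simp
  also have "\<dots> = (\<integral>(x, y). f x y * (\<integral>y. f x y \<partial>M) \<partial>(M \<Otimes>\<^sub>M M))"
    using trip.integral_fst'[OF int] unfolding eq by simp
  finally show "(\<integral>x. f (x i) (x j) * f (x i) (x k) \<partial>PiM I (\<lambda>_. M)) = (\<integral>x. (\<integral>y. f x y \<partial>M)\<^sup>2 \<partial>M)"
    using fub by simp
qed

lemma integral_kernel_disjoint_coordinates:
  assumes "i \<in> I" "j \<in> I" "k \<in> I" "l \<in> I" "i \<noteq> j" "k \<noteq> l" "{i, j} \<inter> {k, l} = {}"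
    and mean: "(\<integral>(x, y). f x y \<partial>(M \<Otimes>\<^sub>M M)) = 0"
  shows "(\<integral>x. f (x i) (x j) * f (x k) (x l) \<partial>PiM I (\<lambda>_. M)) = 0"
proof -
  interpret PX: prob_space "PiM I (\<lambda>_. M)" by (intro prob_space_PiM prob_space_axioms)
  have meas: "(\<lambda>x. f (x i) (x j)) \<in> borel_measurable (PiM {i, j} (\<lambda>_. M))" if "i \<noteq> j" for i j :: 'b
    using that by (intro integral_kernel_coordinates) auto
  have "PX.indep_var borel (\<lambda>x. (\<lambda>x. f (x i) (x j)) (restrict x {i, j}))
      borel (\<lambda>x. (\<lambda>x. f (x k) (x l)) (restrict x {k, l}))"
    by (rule indep_var_disjoint_coordinates) (use assms meas in auto)
  then have ind: "PX.indep_var borel (\<lambda>x. f (x i) (x j)) borel (\<lambda>x. f (x k) (x l))" by simp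
  have int: "integrable (PiM I (\<lambda>_. M)) (\<lambda>x. f (x i) (x j))" if "i \<in> I" "j \<in> I" "i \<noteq> j" for i j
    by (rule PX.square_integrable_imp_integrable[OF integral_kernel_coordinates(1,2)[OF that]])
  have "(\<integral>x. f (x i) (x j) * f (x k) (x l) \<partial>PiM I (\<lambda>_. M))
      = (\<integral>x. f (x i) (x j) \<partial>PiM I (\<lambda>_. M)) * (\<integral>x. f (x k) (x l) \<partial>PiM I (\<lambda>_. M))"
    by (rule PX.indep_var_lebesgue_integral[OF ind int int]) (use assms in auto)
  also have "(\<integral>x. f (x i) (x j) \<partial>PiM I (\<lambda>_. M)) = 0"
    using integral_kernel_coordinates(4)[of i I j] mean assms by simp
  finally show ?thesis by simp
qed

text \<open>The kernel times its projection integrates to the squared projection, so the second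
  moment of the residual equals the difference of the two sides and is nonnegative.\<close>

lemma kernel_projection_le:
  shows "(\<integral>x. (\<integral>y. f x y \<partial>M)\<^sup>2 \<partial>M) \<le> (\<integral>(x, y). (f x y)\<^sup>2 \<partial>(M \<Otimes>\<^sub>M M))"
proof -
  note [measurable] = f_meas
  note * = integral_kernel_shared_coordinate[of 1 "{1, 2, 3 :: nat}" 2 3]
  let ?g = "\<lambda>x. \<integral>y. f x y \<partial>M"
  have fst: "distr (M \<Otimes>\<^sub>M M) M fst = M" by (rule distr_pair_fst)
  have mfst: "fst \<in> measurable (M \<Otimes>\<^sub>M M) M" and g2: "(\<lambda>x. (?g x)\<^sup>2) \<in> borel_measurable M"
    by measurable
  have ig: "integrable (M \<Otimes>\<^sub>M M) (\<lambda>(x, y). (?g x)\<^sup>2)"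
    using integrable_distr[OF mfst, of "\<lambda>x. (?g x)\<^sup>2"] *(4) by (simp add: fst case_prod_beta')
  have Eg: "(\<integral>(x, y). (?g x)\<^sup>2 \<partial>(M \<Otimes>\<^sub>M M)) = (\<integral>x. (?g x)\<^sup>2 \<partial>M)"
    using integral_distr[OF mfst g2] by (simp add: fst case_prod_beta')
  have "0 \<le> (\<integral>(x, y). (f x y - ?g x)\<^sup>2 \<partial>(M \<Otimes>\<^sub>M M))"
    by (intro integral_nonneg_AE) auto
  also have "(\<integral>(x, y). (f x y - ?g x)\<^sup>2 \<partial>(M \<Otimes>\<^sub>M M))
      = (\<integral>p. ((\<lambda>(x, y). (f x y)\<^sup>2) p + (\<lambda>(x, y). (?g x)\<^sup>2) p) - 2 * (\<lambda>(x, y). f x y * ?g x) p \<partial>(M \<Otimes>\<^sub>M M))"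
    by (intro Bochner_Integration.integral_cong) (auto simp: power2_diff)
  also have "\<dots> = ((\<integral>(x, y). (f x y)\<^sup>2 \<partial>(M \<Otimes>\<^sub>M M)) + (\<integral>(x, y). (?g x)\<^sup>2 \<partial>(M \<Otimes>\<^sub>M M)))
      - 2 * (\<integral>(x, y). f x y * ?g x \<partial>(M \<Otimes>\<^sub>M M))"
    using f_sq ig *(2) by (subst Bochner_Integration.integral_diff) auto
  finally show ?thesis using *(3) Eg by simp
qed

text \<open>Hoeffding's covariance formula: only the number of shared indices matters. Symmetry of
  \<open>f\<close> moves a shared index to the first argument, which reduces the four possible
  coincidences to one.\<close>

lemma kernel_covariance:
  assumes "e \<in> pairs n" "e' \<in> pairs n"
    and sym: "\<And>x y. x \<in> space M \<Longrightarrow> y \<in> space M \<Longrightarrow> f x y = f y x"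
    and mean: "(\<integral>(x, y). f x y \<partial>(M \<Otimes>\<^sub>M M)) = 0"
  shows "(\<integral>x. f (x (fst e)) (x (snd e)) * f (x (fst e')) (x (snd e')) \<partial>PiM {1..n} (\<lambda>_. M)) =
    (if e' = e then \<integral>(x, y). (f x y)\<^sup>2 \<partial>(M \<Otimes>\<^sub>M M)
     else if meets e e' then \<integral>x. (\<integral>y. f x y \<partial>M)\<^sup>2 \<partial>M else 0)"
proof -
  obtain i j k l where e: "e = (i, j)" "e' = (k, l)" and
    ij: "1 \<le> i" "i < j" "j \<le> n" and kl: "1 \<le> k" "k < l" "l \<le> n"
    using assms by (auto simp: pairs_def)
  let ?I = "{1..n}"
  have swap: "f (x i) (x j) = f (x j) (x i)" if "x \<in> space (PiM ?I (\<lambda>_. M))" "i \<in> ?I" "j \<in> ?I" for x i j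
    using that by (intro sym) (auto simp: space_PiM)
  consider "e' = e" | "e' \<noteq> e" "\<not> meets e e'" | "e' \<noteq> e" "meets e e'" by blast
  then show ?thesis
  proof cases
    case 1
    then show ?thesis
      using integral_kernel_coordinates(3)[of i ?I j] e ij by (simp add: power2_eq_square)
  next
    case 2
    then show ?thesis
      using integral_kernel_disjoint_coordinates[of i ?I j k l] mean e ij kl by (simp add: meets_def)
  next
    case 3
    have cov: "(\<integral>x. F x * G x \<partial>PiM ?I (\<lambda>_. M)) = (\<integral>x. (\<integral>y. f x y \<partial>M)\<^sup>2 \<partial>M)"
      if "a \<in> ?I" "b \<in> ?I" "c \<in> ?I" "a \<noteq> b" "c \<noteq> a" "c \<noteq> b"
        and "\<And>x. x \<in> space (PiM ?I (\<lambda>_. M)) \<Longrightarrow> F x = f (x a) (x b)"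
        and "\<And>x. x \<in> space (PiM ?I (\<lambda>_. M)) \<Longrightarrow> G x = f (x a) (x c)" for F G a b c
      using integral_kernel_shared_coordinate(1)[OF that(1-6)] that(7,8)
      by (subst Bochner_Integration.integral_cong[OF refl, of _ _ "\<lambda>x. f (x a) (x b) * f (x a) (x c)"]) auto
    have "(i = k \<and> j \<noteq> l) \<or> (i = l \<and> j \<noteq> k) \<or> (j = k \<and> i \<noteq> l) \<or> (j = l \<and> i \<noteq> k)"
      using 3 e ij kl by (auto simp: meets_def)
    then have "(\<integral>x. f (x i) (x j) * f (x k) (x l) \<partial>PiM ?I (\<lambda>_. M)) = (\<integral>x. (\<integral>y. f x y \<partial>M)\<^sup>2 \<partial>M)"
    proof (elim disjE)
      assume "i = k \<and> j \<noteq> l"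
      then show ?thesis using ij kl by (intro cov[of i j l]) auto
    next
      assume "i = l \<and> j \<noteq> k"
      then show ?thesis using ij kl swap[of _ k l] by (intro cov[of i j k]) auto
    next
      assume "j = k \<and> i \<noteq> l"
      then show ?thesis using ij kl swap[of _ i j] by (intro cov[of j i l]) auto
    next
      assume "j = l \<and> i \<noteq> k"
      then show ?thesis using ij kl swap[of _ i j] swap[of _ k l] by (intro cov[of j i k]) auto
    qed
    then show ?thesis using 3 e by auto
  qed
qed

end

end

section \<open>Mean squared error of incomplete U-statistics\<close>

text \<open>Everything here depends on the law \<open>D\<close> of one observation only: the sample
  is a point of a power of \<open>D\<close>, and the original probability space returns at the final
  transfer.\<close>

locale symmetric_kernel = prob_space D for D :: "'z measure" +
  fixes h :: "'z \<Rightarrow> 'z \<Rightarrow> real ^ 'd"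
  assumes h_meas: "(\<lambda>(x, y). h x y) \<in> borel_measurable (D \<Otimes>\<^sub>M D)"
    and h_sym: "\<And>x y. x \<in> space D \<Longrightarrow> y \<in> space D \<Longrightarrow> h x y = h y x"
    and h_sq: "integrable (D \<Otimes>\<^sub>M D) (\<lambda>(x, y). (norm (h x y))\<^sup>2)"
begin

definition mean :: "real ^ 'd" where
  "mean = (\<integral>(x, y). h x y \<partial>(D \<Otimes>\<^sub>M D))"

text \<open>Each coordinate is a real kernel with mean 0, to which the covariance lemmas apply; the
  trace of a covariance matrix is the sum over the coordinates.\<close>

definition centered :: "'d \<Rightarrow> 'z \<Rightarrow> 'z \<Rightarrow> real" where
  "centered c x y = h x y $ c - mean $ c"

definition var :: real where
  "var = (\<Sum>c\<in>UNIV. \<integral>(x, y). (centered c x y)\<^sup>2 \<partial>(D \<Otimes>\<^sub>M D))"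

text \<open>The inner integral has mean 0 already, so its second moment is a variance.\<close>

definition proj_var :: real where
  "proj_var = (\<Sum>c\<in>UNIV. \<integral>x. (\<integral>y. centered c x y \<partial>D)\<^sup>2 \<partial>D)"

sublocale DD: pair_prob_space D D ..

lemma component_meas: "(\<lambda>(x, y). h x y $ c) \<in> borel_measurable (D \<Otimes>\<^sub>M D)"
  using measurable_compose[OF h_meas, of "\<lambda>v. v $ c" borel] by (simp add: case_prod_beta')

lemma h_integrable: "integrable (D \<Otimes>\<^sub>M D) (\<lambda>(x, y). h x y)"
proof -
  have "(\<lambda>p. norm ((\<lambda>(x, y). h x y) p)) \<in> borel_measurable (D \<Otimes>\<^sub>M D)"
    using h_meas by measurable
  then have "integrable (D \<Otimes>\<^sub>M D) (\<lambda>p. norm ((\<lambda>(x, y). h x y) p))"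
    by (rule DD.P.square_integrable_imp_integrable) (use h_sq in \<open>simp add: case_prod_beta'\<close>)
  then show ?thesis
    by (rule integrable_norm_cancel[OF _ h_meas])
qed

lemma component_integrable: "integrable (D \<Otimes>\<^sub>M D) (\<lambda>(x, y). h x y $ c)"
  using integrable_bounded_linear[OF bounded_linear_vec_nth h_integrable, of c]
  by (simp add: case_prod_beta')

lemma component_integral: "(\<integral>(x, y). h x y $ c \<partial>(D \<Otimes>\<^sub>M D)) = mean $ c"
  using integral_bounded_linear[OF bounded_linear_vec_nth h_integrable, of c]
  by (simp add: case_prod_beta' mean_def)

lemma component_square_integrable: "integrable (D \<Otimes>\<^sub>M D) (\<lambda>(x, y). (h x y $ c)\<^sup>2)"
proof (rule Bochner_Integration.integrable_bound[OF h_sq])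
  show "(\<lambda>(x, y). (h x y $ c)\<^sup>2) \<in> borel_measurable (D \<Otimes>\<^sub>M D)"
    using borel_measurable_power[OF component_meas[of c], of 2] by (simp add: case_prod_beta')
  have "(h x y $ c)\<^sup>2 \<le> (norm (h x y))\<^sup>2" for x y
    using component_le_norm_cart[of "h x y" c] power_mono[of "\<bar>h x y $ c\<bar>" "norm (h x y)" 2] by simp
  then show "AE p in D \<Otimes>\<^sub>M D. norm (case p of (x, y) \<Rightarrow> (h x y $ c)\<^sup>2) \<le> norm (case p of (x, y) \<Rightarrow> (norm (h x y))\<^sup>2)"
    by (auto simp: case_prod_beta')
qed

lemma centered_meas: "(\<lambda>(x, y). centered c x y) \<in> borel_measurable (D \<Otimes>\<^sub>M D)"
  using borel_measurable_diff[OF component_meas[of c] borel_measurable_const[of "mean $ c"]]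
  by (simp add: centered_def case_prod_beta')

lemma centered_square_integrable: "integrable (D \<Otimes>\<^sub>M D) (\<lambda>(x, y). (centered c x y)\<^sup>2)"
proof -
  have "integrable (D \<Otimes>\<^sub>M D) (\<lambda>p. (\<lambda>(x, y). (h x y $ c)\<^sup>2) p - 2 * mean $ c * (\<lambda>(x, y). h x y $ c) p + (mean $ c)\<^sup>2)"
    using component_square_integrable[of c] component_integrable[of c] by simp
  then show ?thesis
    by (rule Bochner_Integration.integrable_cong[THEN iffD1, OF refl, rotated])
      (auto simp: centered_def power2_diff)
qed

lemma centered_integral: "(\<integral>(x, y). centered c x y \<partial>(D \<Otimes>\<^sub>M D)) = 0"
proof -
  have "(\<integral>(x, y). centered c x y \<partial>(D \<Otimes>\<^sub>M D)) = (\<integral>p. (\<lambda>(x, y). h x y $ c) p - mean $ c \<partial>(D \<Otimes>\<^sub>M D))"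
    by (simp add: centered_def case_prod_beta')
  also have "\<dots> = 0"
    using component_integrable[of c] component_integral[of c]
    by (subst Bochner_Integration.integral_diff) (auto simp: DD.P.prob_space)
  finally show ?thesis .
qed

lemma centered_sym: "x \<in> space D \<Longrightarrow> y \<in> space D \<Longrightarrow> centered c x y = centered c y x"
  by (simp add: centered_def h_sym)

lemma proj_var_nonneg: "0 \<le> proj_var"
  unfolding proj_var_def by (intro sum_nonneg integral_nonneg_AE) auto

lemma proj_var_le_var: "proj_var \<le> var"
  unfolding proj_var_def var_def
  by (intro sum_mono kernel_projection_le centered_meas centered_square_integrable)

lemma sum_kernel_covariance:
  assumes "e \<in> pairs n" "e' \<in> pairs n"
  shows "(\<Sum>c\<in>UNIV. \<integral>x. centered c (x (fst e)) (x (snd e)) * centered c (x (fst e')) (x (snd e')) \<partial>PiM {1..n} (\<lambda>_. D))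
    = (if e' = e then var else if meets e e' then proj_var else 0)"
  by (subst kernel_covariance[OF centered_meas centered_square_integrable assms centered_sym centered_integral])
    (auto simp: var_def proj_var_def)

lemma incomplete_U_minus_mean:
  assumes "length js = M" "0 < M"
  shows "(incomplete_U M h x js - mean) $ c
    = (\<Sum>a<M. centered c (x (fst (js ! a))) (x (snd (js ! a)))) / M"
proof -
  have "(\<Sum>(i, j)\<leftarrow>js. h (x i) (x j)) = (\<Sum>a<M. h (x (fst (js ! a))) (x (snd (js ! a))))"
    using assms by (simp add: sum_list_sum_nth case_prod_beta atLeast0LessThan)
  then show ?thesis
    using assms by (simp add: incomplete_U_def centered_def sum_subtractf diff_divide_distrib)
qed

text \<open>Only the sample is random here. The squared norm expands over coordinates and over
  couples of draws, and each couple contributes its covariance summed over coordinates; repeated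
  draws fall under the case \<open>e' = e\<close>.\<close>

lemma incomplete_U_mse:
  assumes js: "js \<in> blocks s n M" and M: "0 < M"
  defines "PX \<equiv> PiM {1..n} (\<lambda>_. D)"
    and "C \<equiv> \<lambda>e e'. if e' = e then var else if meets e e' then proj_var else 0"
  shows "integrable PX (\<lambda>x. (norm (incomplete_U M h x js - mean))\<^sup>2)" (is ?int)
    and "(\<integral>x. (norm (incomplete_U M h x js - mean))\<^sup>2 \<partial>PX)
      = (\<Sum>a<M. \<Sum>b<M. C (js ! a) (js ! b)) / (real M)\<^sup>2" (is ?eq)
proof -
  let ?f = "\<lambda>c a x. centered c (x (fst (js ! a))) (x (snd (js ! a)))"
  have len: "length js = M" using js by (simp add: blocks_def)
  have mem: "js ! a \<in> pairs n" if "a < M" for a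
    using js that nth_mem[of a js] unfolding blocks_def by blast
  have idx: "fst (js ! a) \<in> {1..n}" "snd (js ! a) \<in> {1..n}" "fst (js ! a) \<noteq> snd (js ! a)" if "a < M" for a
    using mem[OF that] by (auto simp: pairs_def)
  have int: "integrable PX (\<lambda>x. ?f c a x * ?f c b x)" if "a < M" "b < M" for a b c
    unfolding PX_def using idx that
    by (intro integrable_mult_of_squares integral_kernel_coordinates centered_meas
        centered_square_integrable) auto
  have norm: "(norm (incomplete_U M h x js - mean))\<^sup>2 = (\<Sum>c\<in>UNIV. (\<Sum>a<M. \<Sum>b<M. ?f c a x * ?f c b x) / (real M)\<^sup>2)"
    for x
  proof -
    have "(norm (incomplete_U M h x js - mean))\<^sup>2 = (\<Sum>c\<in>UNIV. ((incomplete_U M h x js - mean) $ c)\<^sup>2)"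
      unfolding power2_norm_eq_inner inner_vec_def by (simp add: power2_eq_square)
    also have "\<dots> = (\<Sum>c\<in>UNIV. (\<Sum>a<M. \<Sum>b<M. ?f c a x * ?f c b x) / (real M)\<^sup>2)"
      by (simp only: incomplete_U_minus_mean[OF len M] power2_eq_square times_divide_times_eq sum_product)
    finally show ?thesis .
  qed
  have int2: "integrable PX (\<lambda>x. \<Sum>b<M. ?f c a x * ?f c b x)" if "a < M" for a c
    by (intro Bochner_Integration.integrable_sum int that) simp
  have int3: "integrable PX (\<lambda>x. \<Sum>a<M. \<Sum>b<M. ?f c a x * ?f c b x)" for c
    by (intro Bochner_Integration.integrable_sum int2) simp
  show ?int
    unfolding norm by (intro Bochner_Integration.integrable_sum integrable_divide int3)
  have "(\<integral>x. (norm (incomplete_U M h x js - mean))\<^sup>2 \<partial>PX)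
      = (\<Sum>c\<in>UNIV. \<integral>x. (\<Sum>a<M. \<Sum>b<M. ?f c a x * ?f c b x) / (real M)\<^sup>2 \<partial>PX)"
    unfolding norm by (intro Bochner_Integration.integral_sum integrable_divide int3)
  also have "\<dots> = (\<Sum>c\<in>UNIV. (\<Sum>a<M. \<Sum>b<M. \<integral>x. ?f c a x * ?f c b x \<partial>PX) / (real M)\<^sup>2)"
  proof (intro sum.cong refl)
    fix c
    have "(\<integral>x. (\<Sum>a<M. \<Sum>b<M. ?f c a x * ?f c b x) \<partial>PX) = (\<Sum>a<M. \<integral>x. (\<Sum>b<M. ?f c a x * ?f c b x) \<partial>PX)"
      by (intro Bochner_Integration.integral_sum int2) simp
    also have "\<dots> = (\<Sum>a<M. \<Sum>b<M. \<integral>x. ?f c a x * ?f c b x \<partial>PX)"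
      by (intro sum.cong refl Bochner_Integration.integral_sum int) simp_all
    finally show "(\<integral>x. (\<Sum>a<M. \<Sum>b<M. ?f c a x * ?f c b x) / (real M)\<^sup>2 \<partial>PX)
        = (\<Sum>a<M. \<Sum>b<M. \<integral>x. ?f c a x * ?f c b x \<partial>PX) / (real M)\<^sup>2"
      by (simp only: integral_divide_zero)
  qed
  also have "\<dots> = (\<Sum>a<M. \<Sum>b<M. \<Sum>c\<in>UNIV. \<integral>x. ?f c a x * ?f c b x \<partial>PX) / (real M)\<^sup>2"
    unfolding sum_divide_distrib[symmetric] by (subst sum.swap) (simp only: sum.swap[of _ "{..<M}" "UNIV :: 'd set"])
  also have "(\<Sum>a<M. \<Sum>b<M. \<Sum>c\<in>UNIV. \<integral>x. ?f c a x * ?f c b x \<partial>PX) = (\<Sum>a<M. \<Sum>b<M. C (js ! a) (js ! b))"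
    unfolding PX_def C_def using mem by (intro sum.cong refl sum_kernel_covariance) auto
  finally show ?eq .
qed

text \<open>Averaging over the blocks brings in the sampling scheme. Both schemes satisfy the same
  bound: the variance of the complete U-statistic plus the subsampling cost
  \<open>var / M\<close>.\<close>

lemma mean_incomplete_U_mse_le:
  assumes "2 \<le> n" "0 < M"
  defines "PX \<equiv> PiM {1..n} (\<lambda>_. D)"
  shows "(\<Sum>js\<in>blocks s n M. \<integral>x. (norm (incomplete_U M h x js - mean))\<^sup>2 \<partial>PX)
    \<le> card (blocks s n M) *
      (4 * proj_var / n + 2 * (var - 2 * proj_var) / (real n * (real n - 1)) + var / M)"
proof -
  let ?C = "\<lambda>e e'. if e' = e then var else if meets e e' then proj_var else 0"
  let ?v = "4 * proj_var / n + 2 * (var - 2 * proj_var) / (real n * (real n - 1))"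
  have "(\<Sum>js\<in>blocks s n M. \<integral>x. (norm (incomplete_U M h x js - mean))\<^sup>2 \<partial>PX)
      = (\<Sum>js\<in>blocks s n M. \<Sum>a<M. \<Sum>b<M. ?C (js ! a) (js ! b)) / (real M)\<^sup>2"
    unfolding PX_def by (subst sum_divide_distrib) (intro sum.cong refl incomplete_U_mse assms(2))
  also have "\<dots> \<le> card (blocks s n M) * (M * var + (real M)\<^sup>2 * ?v) / (real M)\<^sup>2"
    using assms proj_var_nonneg proj_var_le_var
    by (intro divide_right_mono sum_blocks_covariance) auto
  also have "\<dots> = card (blocks s n M) * (?v + var / M)"
    using assms(2) by (simp add: add_divide_distrib distrib_left power2_eq_square)
  finally show ?thesis .
qed

end

section \<open>Concentration over the sample\<close>

definition vertices :: "(nat \<times> nat) list \<Rightarrow> nat set" where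
  "vertices js = (\<Union>e\<in>set js. {fst e, snd e})"

lemma vertices_subset: "js \<in> blocks s n m \<Longrightarrow> vertices js \<subseteq> {1..n}"
  unfolding blocks_def vertices_def pairs_def
  by (auto dest!: subsetD)

lemma vertices_relabel: "vertices (map (relabel \<sigma>) js) = \<sigma> ` vertices js"
proof -
  have "{fst (relabel \<sigma> e), snd (relabel \<sigma> e)} = {\<sigma> (fst e), \<sigma> (snd e)}" for e
    by (auto simp: relabel_def min_def max_def)
  then show ?thesis by (simp add: vertices_def image_UN)
qed

lemma card_vertices_le: "card (vertices js) \<le> 2 * length js"
proof -
  have "card (vertices js) \<le> card (fst ` set js) + card (snd ` set js)"
    by (rule order_trans[OF _ card_Un_le]) (auto simp: vertices_def intro!: card_mono)
  also have "\<dots> \<le> card (set js) + card (set js)" by (intro add_mono card_image_le) auto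
  also have "\<dots> \<le> 2 * length js" using card_length[of js] by simp
  finally show ?thesis .
qed

text \<open>The windows are consecutive intervals of length \<open>2 * m\<close>. A block of
  \<open>m\<close> pairs touches at most that many indices, so an injection fits it into any window
  and extends to a permutation, which may depend on the block.\<close>

lemma pack_blocks:
  assumes "2 * m * b \<le> n"
  obtains B \<rho> where "\<And>q. q < b \<Longrightarrow> B q \<subseteq> {1..n}" "disjoint_family_on B {..<b}"
    "\<And>q js. q < b \<Longrightarrow> js \<in> blocks s n m \<Longrightarrow> \<rho> q js permutes {1..n}"
    "\<And>q js. q < b \<Longrightarrow> js \<in> blocks s n m \<Longrightarrow> \<rho> q js ` vertices js \<subseteq> B q"
proof -
  define B where "B q = {2 * m * q + 1..2 * m * (q + 1)}" for q
  have sub: "B q \<subseteq> {1..n}" if "q < b" for q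
  proof -
    have "2 * m * (q + 1) \<le> 2 * m * b" using that by (intro mult_left_mono) auto
    then show ?thesis using assms by (auto simp: B_def)
  qed
  have disj: "disjoint_family_on B {..<b}"
  proof -
    have lt: "B p \<inter> B q = {}" if "p < q" for p q
    proof -
      have "2 * m * (p + 1) \<le> 2 * m * q" using that by (intro mult_left_mono) auto
      then show ?thesis by (auto simp: B_def)
    qed
    have "B p \<inter> B q = {}" if "p \<noteq> q" for p q
      using lt[of p q] lt[of q p] that by (cases "p < q") auto
    then show ?thesis by (simp add: disjoint_family_on_def)
  qed
  have ex: "\<exists>\<rho>. \<rho> permutes {1..n} \<and> \<rho> ` vertices js \<subseteq> B q" if q: "q < b" and js: "js \<in> blocks s n m" for q js
  proof -
    have "finite (vertices js)" by (simp add: vertices_def)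
    moreover have "card (vertices js) \<le> card (B q)"
      using card_vertices_le[of js] js by (simp add: B_def blocks_def)
    ultimately obtain f where f: "f ` vertices js \<subseteq> B q" "inj_on f (vertices js)"
      using card_le_inj[of "vertices js" "B q"] by (auto simp: B_def)
    obtain \<rho> where "\<rho> permutes {1..n}" "\<And>v. v \<in> vertices js \<Longrightarrow> \<rho> v = f v"
      using inj_on_extends_to_permutes[OF _ f(2), of "{1..n}"] vertices_subset[OF js] f(1) sub[OF q]
      by (metis finite_atLeastAtMost order_trans)
    then show ?thesis using f(1) by (metis image_cong)
  qed
  define \<rho> where "\<rho> q js = (SOME \<rho>. \<rho> permutes {1..n} \<and> \<rho> ` vertices js \<subseteq> B q)" for q js
  have \<rho>: "\<rho> q js permutes {1..n} \<and> \<rho> q js ` vertices js \<subseteq> B q"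
    if "q < b" "js \<in> blocks s n m" for q js
    unfolding \<rho>_def by (rule someI_ex[OF ex[OF that]])
  show ?thesis by (rule that[of B \<rho>, OF sub disj]) (use \<rho> in blast)+
qed

context prob_space
begin

lemma distr_PiM_permute:
  assumes "\<sigma> permutes I"
  shows "distr (PiM I (\<lambda>_. M)) (PiM I (\<lambda>_. M)) (\<lambda>x. \<lambda>i\<in>I. x (\<sigma> i)) = PiM I (\<lambda>_. M)"
  by (rule distr_PiM_reindex[of I "\<lambda>_. M" \<sigma> I])
    (use assms prob_space_axioms in \<open>simp_all add: permutes_inj_on permutes_in_image Pi_def\<close>)

lemma measurable_permute:
  assumes "\<sigma> permutes I"
  shows "(\<lambda>x. \<lambda>i\<in>I. x (\<sigma> i)) \<in> measurable (PiM I (\<lambda>_. M)) (PiM I (\<lambda>_. M))"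
  using assms by (intro measurable_restrict measurable_component_singleton) (simp add: permutes_in_image)

text \<open>
  Hoeffding's argument for U-statistics: after averaging over all relabelings of the sample, each
  block may be assumed to live on one of \<open>b\<close> disjoint sets of \<open>2 * m\<close> indices, so that the
  statistic is an average of means of \<open>b\<close> independent variables.
\<close>

lemma relabeled_average_tail:
  fixes F :: "(nat \<Rightarrow> 'a) \<Rightarrow> (nat \<times> nat) list \<Rightarrow> real" and s :: sampling and n m b :: nat
  defines "I \<equiv> {1..n}" and "PX \<equiv> PiM {1..n} (\<lambda>_. M)"
  defines "p \<equiv> \<lambda>x. (\<Sum>js\<in>blocks s n m. F x js) / card (blocks s n m)"
  assumes n: "0 < n" and m: "m \<le> card (pairs n)" and b: "0 < b" "2 * m * b \<le> n"
    and range: "\<And>x js. 0 \<le> F x js" "\<And>x js. F x js \<le> 1"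
    and meas: "\<And>A js. js \<in> blocks s n m \<Longrightarrow> vertices js \<subseteq> A \<Longrightarrow> A \<subseteq> I \<Longrightarrow>
      (\<lambda>x. F x js) \<in> borel_measurable (PiM A (\<lambda>_. M))"
    and local: "\<And>x y js. js \<in> blocks s n m \<Longrightarrow> (\<And>i. i \<in> vertices js \<Longrightarrow> x i = y i) \<Longrightarrow> F x js = F y js"
    and equi: "\<And>\<sigma> x js. \<sigma> permutes I \<Longrightarrow> x \<in> space PX \<Longrightarrow> js \<in> blocks s n m \<Longrightarrow>
      F (\<lambda>i\<in>I. x (\<sigma> i)) js = F x (map (relabel \<sigma>) js)"
    and t: "0 < t"
  shows "measure PX {x \<in> space PX. p x \<ge> (\<integral>x. p x \<partial>PX) + t} \<le> exp (- 2 * real b * t\<^sup>2)"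
proof -
  let ?B = "blocks s n m"
  define N where "N = real (card ?B)"
  define perms where "perms = {\<sigma>. \<sigma> permutes I}"
  define act where "act \<sigma> x = (\<lambda>i\<in>I. x (\<sigma> i))" for \<sigma> and x :: "nat \<Rightarrow> 'a"
  define \<mu> where "\<mu> = (\<integral>x. p x \<partial>PX)"
  \<comment> \<open>Minimizer of the Chernoff exponent - l * t + l^2 / (8 * b); the minimum is - 2 *
    b * t^2.\<close>
  define l where "l = 4 * real b * t"
  have l: "l > 0" "l / b > 0" using b t by (auto simp: l_def)
  interpret PX: prob_space PX unfolding PX_def by (intro prob_space_PiM prob_space_axioms)
  have N: "N > 0" using blocks_nonempty[OF m, of s] by (simp add: N_def card_gt_0_iff)
  have perms: "finite perms" "perms \<noteq> {}"
    unfolding perms_def using permutes_id[of I] finite_permutations[of I] by (auto simp only: I_def finite_atLeastAtMost)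
  have ne: "I \<noteq> {}" using n by (simp add: I_def)
  obtain B \<rho> where B: "\<And>q. q < b \<Longrightarrow> B q \<subseteq> I" "disjoint_family_on B {..<b}"
    and \<rho>: "\<And>q js. q < b \<Longrightarrow> js \<in> ?B \<Longrightarrow> \<rho> q js permutes I"
      "\<And>q js. q < b \<Longrightarrow> js \<in> ?B \<Longrightarrow> \<rho> q js ` vertices js \<subseteq> B q"
    using pack_blocks[OF b(2), of s] unfolding I_def by metis
  \<comment> \<open>A copy of the block inside window \<open>q\<close>. Since every block has its
    own permutation, \<open>g q\<close> averages over all blocks and yet reads only the observations
    in that window; it is not \<open>p\<close> itself but has the same mean.\<close>
  define emb where "emb q js = map (relabel (\<rho> q js)) js" for q js
  define g where "g q x = (\<Sum>js\<in>?B. F x (emb q js)) / N" for q x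
  define G where "G x = (\<Sum>q<b. g q x) / b" for x
  have map_blocks: "map (relabel \<sigma>) js \<in> ?B" if "\<sigma> permutes I" "js \<in> ?B" for \<sigma> js
    using bij_betw_map_blocks[OF bij_betw_relabel, of \<sigma> n s m] that by (auto simp: bij_betw_def I_def)
  have emb: "emb q js \<in> ?B" "vertices (emb q js) \<subseteq> B q" if "q < b" "js \<in> ?B" for q js
    using map_blocks \<rho> that by (auto simp: emb_def vertices_relabel)
  have act_space: "act \<sigma> x \<in> space PX" if "\<sigma> permutes I" "x \<in> space PX" for \<sigma> x
    using measurable_space[OF measurable_permute[OF that(1)], of x] that(2)
    by (simp add: PX_def act_def I_def)
  have act_meas: "act \<sigma> \<in> measurable PX PX" if "\<sigma> permutes I" for \<sigma>
    using measurable_permute[OF that] by (simp add: PX_def act_def[abs_def] I_def)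
  have act_law: "distr PX PX (act \<sigma>) = PX" if "\<sigma> permutes I" for \<sigma>
    using distr_PiM_permute[OF that] by (simp add: PX_def act_def[abs_def] I_def)
  have F_meas [measurable]: "(\<lambda>x. F x js) \<in> borel_measurable PX" if "js \<in> ?B" for js
    using meas[OF that vertices_subset[OF that]] by (simp add: PX_def I_def)
  have F_int: "integrable PX (\<lambda>x. F x js)" if "js \<in> ?B" for js
    using F_meas[OF that] range by (intro PX.integrable_const_bound[of _ 1]) auto
  have g_local_meas: "(\<lambda>x. g q x) \<in> borel_measurable (PiM (B q) (\<lambda>_. M))" if "q < b" for q
    unfolding g_def using emb[OF that] B(1)[OF that]
    by (intro borel_measurable_divide borel_measurable_sum borel_measurable_const meas) auto
  have g_meas: "g q \<in> borel_measurable PX" if "q < b" for q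
    unfolding g_def[abs_def] using emb[OF that]
    by (intro borel_measurable_divide borel_measurable_sum borel_measurable_const F_meas) auto
  have g_range: "0 \<le> g q x" "g q x \<le> 1" for q x
  proof -
    show "0 \<le> g q x" using range N by (auto simp: g_def intro!: divide_nonneg_pos sum_nonneg)
    have "(\<Sum>js\<in>?B. F x (emb q js)) \<le> (\<Sum>js\<in>?B. 1)" using range by (intro sum_mono)
    then show "g q x \<le> 1" using N by (simp add: g_def N_def)
  qed
  have G_meas: "G \<in> borel_measurable PX"
    unfolding G_def[abs_def] using g_meas
    by (intro borel_measurable_divide borel_measurable_sum borel_measurable_const) auto
  have p_meas: "p \<in> borel_measurable PX"
    unfolding p_def using F_meas
    by (intro borel_measurable_divide borel_measurable_sum borel_measurable_const) auto
  \<comment> \<open>Averaging over all relabelings undoes the embeddings, because composing with a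
    fixed permutation permutes the group, and each relabeling permutes the blocks.\<close>
  have p_eq: "p x = (\<Sum>\<sigma>\<in>perms. G (act \<sigma> x)) / card perms" if x: "x \<in> space PX" for x
  proof -
    have sum_act: "(\<Sum>\<sigma>\<in>perms. g q (act \<sigma> x)) = card perms * p x" if q: "q < b" for q
    proof -
      have "(\<Sum>\<sigma>\<in>perms. F (act \<sigma> x) (emb q js)) = (\<Sum>\<sigma>\<in>perms. F x (map (relabel \<sigma>) js))"
        if js: "js \<in> ?B" for js
      proof -
        have "(\<Sum>\<sigma>\<in>perms. F (act \<sigma> x) (emb q js)) = (\<Sum>\<sigma>\<in>perms. F x (map (relabel (\<sigma> \<circ> \<rho> q js)) js))"
        proof (intro sum.cong refl)
          fix \<sigma> assume "\<sigma> \<in> perms"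
          then have "F (act \<sigma> x) (emb q js) = F x (map (relabel \<sigma>) (emb q js))"
            unfolding act_def perms_def by (intro equi x emb(1)[OF q js]) simp
          also have "map (relabel \<sigma>) (emb q js) = map (relabel (\<sigma> \<circ> \<rho> q js)) js"
            by (simp add: emb_def relabel_compose)
          finally show "F (act \<sigma> x) (emb q js) = F x (map (relabel (\<sigma> \<circ> \<rho> q js)) js)" .
        qed
        also have "\<dots> = (\<Sum>\<sigma>\<in>perms. F x (map (relabel \<sigma>) js))"
          unfolding perms_def
          by (rule sum_permutations_compose_right[OF \<rho>(1)[OF q js], symmetric])
        finally show ?thesis .
      qed
      then have "(\<Sum>\<sigma>\<in>perms. g q (act \<sigma> x)) = (\<Sum>js\<in>?B. \<Sum>\<sigma>\<in>perms. F x (map (relabel \<sigma>) js)) / N"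
        unfolding g_def sum_divide_distrib[symmetric] by (subst sum.swap) simp
      also have "\<dots> = (\<Sum>\<sigma>\<in>perms. \<Sum>js\<in>?B. F x (map (relabel \<sigma>) js)) / N"
        by (subst sum.swap) simp
      also have "\<dots> = (\<Sum>\<sigma>\<in>perms. \<Sum>js\<in>?B. F x js) / N"
      proof -
        have "(\<Sum>js\<in>?B. F x (map (relabel \<sigma>) js)) = (\<Sum>js\<in>?B. F x js)" if "\<sigma> \<in> perms" for \<sigma>
          using that
          by (intro sum.reindex_bij_betw bij_betw_map_blocks bij_betw_relabel) (simp add: perms_def I_def)
        then show ?thesis by simp
      qed
      finally show ?thesis by (simp add: p_def N_def)
    qed
    have "(\<Sum>\<sigma>\<in>perms. G (act \<sigma> x)) = (\<Sum>q<b. \<Sum>\<sigma>\<in>perms. g q (act \<sigma> x)) / b"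
      unfolding G_def sum_divide_distrib[symmetric] by (subst sum.swap) simp
    also have "\<dots> = card perms * p x" using sum_act b by simp
    finally show ?thesis using perms by simp
  qed
  \<comment> \<open>The product law is invariant under permuting coordinates, so a block and its
    copy have equal expectations.\<close>
  have Eg: "(\<integral>x. g q x \<partial>PX) = \<mu>" if q: "q < b" for q
  proof -
    have "(\<integral>x. F x (emb q js) \<partial>PX) = (\<integral>x. F x js \<partial>PX)" if js: "js \<in> ?B" for js
    proof -
      note \<rho>' = \<rho>(1)[OF q js]
      have "(\<integral>x. F x js \<partial>PX) = (\<integral>x. F x js \<partial>distr PX PX (act (\<rho> q js)))"
        by (simp add: act_law[OF \<rho>'])
      also have "\<dots> = (\<integral>x. F (act (\<rho> q js) x) js \<partial>PX)"
        by (rule integral_distr[OF act_meas[OF \<rho>'] F_meas[OF js]])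
      also have "\<dots> = (\<integral>x. F x (emb q js) \<partial>PX)"
        using equi[OF \<rho>' _ js] by (intro Bochner_Integration.integral_cong) (auto simp: act_def emb_def)
      finally show ?thesis ..
    qed
    then show ?thesis
      using F_int emb(1)[OF q] by (simp add: g_def \<mu>_def p_def N_def Bochner_Integration.integral_sum)
  qed
  \<comment> \<open>Convexity takes the average over relabelings out of the exponential, so the
    dependence between the relabeled copies of \<open>G\<close> does no harm.\<close>
  have jensen: "exp (l * (p x - \<mu>)) \<le> (\<Sum>\<sigma>\<in>perms. (1 / card perms) * exp (l * (G (act \<sigma> x) - \<mu>)))"
    if "x \<in> space PX" for x
  proof -
    have "p x - \<mu> = (\<Sum>\<sigma>\<in>perms. (1 / card perms) *\<^sub>R (G (act \<sigma> x) - \<mu>))"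
      using perms by (simp add: p_eq[OF that] sum_subtractf sum_divide_distrib[symmetric] diff_divide_distrib)
    moreover have "exp (l * (\<Sum>\<sigma>\<in>perms. (1 / card perms) *\<^sub>R (G (act \<sigma> x) - \<mu>)))
        \<le> (\<Sum>\<sigma>\<in>perms. (1 / card perms) * exp (l * (G (act \<sigma> x) - \<mu>)))"
      using perms l by (intro convex_on_sum[OF _ _ convex_on_exp]) auto
    ultimately show ?thesis by simp
  qed
  \<comment> \<open>Disjoint windows give independence, as \<open>g q\<close> reads only the
    coordinates in \<open>B q\<close>.\<close>
  have "PX.indep_vars (\<lambda>q. PiM (B q) (\<lambda>_. M)) (\<lambda>q x. restrict (\<lambda>i. x i) (B q)) {..<b}"
    unfolding PX_def using B ne indep_vars_coordinates[of I]
    by (intro prob_space.indep_vars_restrict[where I = I] prob_space_PiM prob_space_axioms)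
      (auto simp: I_def)
  from PX.indep_vars_compose2[OF this, of g "\<lambda>_. borel"] g_local_meas
  have "PX.indep_vars (\<lambda>_. borel) (\<lambda>q x. g q (restrict (\<lambda>i. x i) (B q))) {..<b}" by simp
  moreover have "g q (restrict (\<lambda>i. x i) (B q)) = g q x" if q: "q < b" for q x
    unfolding g_def using emb[OF q] by (intro arg_cong2[where f = "(/)"] sum.cong local) auto
  ultimately have ind: "PX.indep_vars (\<lambda>_. borel) g {..<b}"
    by (subst (asm) PX.indep_vars_cong[where J = "{..<b}" and Y = g]) auto
  have mgf: "(\<integral>\<^sup>+x. exp (l * (G x - \<mu>)) \<partial>PX) \<le> ennreal (exp (l\<^sup>2 / (8 * b)))"
  proof -
    have "(\<integral>\<^sup>+x. exp (l * (G x - \<mu>)) \<partial>PX) = (\<integral>\<^sup>+x. (\<Prod>q<b. ennreal (exp (l / b * (g q x - \<mu>)))) \<partial>PX)"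
    proof (intro nn_integral_cong)
      fix x
      have "l * (G x - \<mu>) = (\<Sum>q<b. l / b * (g q x - \<mu>))"
        unfolding sum_distrib_left[symmetric] sum_subtractf using b by (simp add: G_def field_simps)
      then show "ennreal (exp (l * (G x - \<mu>))) = (\<Prod>q<b. ennreal (exp (l / b * (g q x - \<mu>))))"
        by (simp add: exp_sum prod_ennreal)
    qed
    also have "\<dots> = (\<Prod>q<b. \<integral>\<^sup>+x. ennreal (exp (l / b * (g q x - \<mu>))) \<partial>PX)"
      by (intro PX.indep_vars_nn_integral PX.indep_vars_compose2[OF ind]) auto
    also have "\<dots> \<le> (\<Prod>q<b. ennreal (exp ((l / b)\<^sup>2 * (1 - 0)\<^sup>2 / 8)))"
    proof (intro prod_mono_ennreal)
      fix q assume q: "q \<in> {..<b}"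
      interpret interval_bounded_random_variable PX "g q" 0 1
        by unfold_locales (use q g_meas g_range in auto)
      show "(\<integral>\<^sup>+x. ennreal (exp (l / b * (g q x - \<mu>))) \<partial>PX) \<le> ennreal (exp ((l / b)\<^sup>2 * (1 - 0)\<^sup>2 / 8))"
        using Hoeffdings_lemma_nn_integral[OF l(2)] Eg q by simp
    qed
    also have "\<dots> = ennreal (exp (l\<^sup>2 / (8 * b)))"
      using b by (simp add: prod_ennreal ennreal_power exp_of_nat_mult[symmetric] field_simps power2_eq_square)
    finally show ?thesis .
  qed
  have "(\<integral>\<^sup>+x. exp (l * (p x - \<mu>)) \<partial>PX)
      \<le> (\<integral>\<^sup>+x. (\<Sum>\<sigma>\<in>perms. ennreal (1 / card perms) * ennreal (exp (l * (G (act \<sigma> x) - \<mu>)))) \<partial>PX)"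
  proof (intro nn_integral_mono)
    fix x assume "x \<in> space PX"
    from ennreal_leI[OF jensen[OF this]]
    show "ennreal (exp (l * (p x - \<mu>)))
        \<le> (\<Sum>\<sigma>\<in>perms. ennreal (1 / card perms) * ennreal (exp (l * (G (act \<sigma> x) - \<mu>))))"
      by (simp add: sum_ennreal ennreal_mult[symmetric] del: times_divide_eq_left)
  qed
  also have "\<dots> = (\<Sum>\<sigma>\<in>perms. ennreal (1 / card perms) * (\<integral>\<^sup>+x. exp (l * (G (act \<sigma> x) - \<mu>)) \<partial>PX))"
  proof -
    have "(\<lambda>x. ennreal (exp (l * (G (act \<sigma> x) - \<mu>)))) \<in> borel_measurable PX" if "\<sigma> \<in> perms" for \<sigma>
      using measurable_compose[OF act_meas G_meas] that by (simp add: perms_def)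
    then show ?thesis
      by (subst nn_integral_sum) (auto intro!: sum.cong nn_integral_cmult)
  qed
  \<comment> \<open>Every relabeled copy has the law of \<open>G\<close>, so the average collapses
    to a single moment generating function.\<close>
  also have "\<dots> = (\<Sum>\<sigma>\<in>perms. ennreal (1 / card perms) * (\<integral>\<^sup>+x. exp (l * (G x - \<mu>)) \<partial>PX))"
  proof (intro sum.cong refl arg_cong2[where f = "(*)"])
    fix \<sigma> assume "\<sigma> \<in> perms"
    then have \<sigma>: "\<sigma> permutes I" by (simp add: perms_def)
    have "(\<integral>\<^sup>+x. exp (l * (G x - \<mu>)) \<partial>distr PX PX (act \<sigma>)) = (\<integral>\<^sup>+x. exp (l * (G (act \<sigma> x) - \<mu>)) \<partial>PX)"
      by (rule nn_integral_distr[OF act_meas[OF \<sigma>]]) (use G_meas in simp)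
    then show "(\<integral>\<^sup>+x. exp (l * (G (act \<sigma> x) - \<mu>)) \<partial>PX) = (\<integral>\<^sup>+x. exp (l * (G x - \<mu>)) \<partial>PX)"
      by (simp only: act_law[OF \<sigma>])
  qed
  also have "\<dots> = (\<integral>\<^sup>+x. exp (l * (G x - \<mu>)) \<partial>PX)"
  proof -
    have "of_nat (card perms) * ennreal (1 / card perms) = 1"
      using perms by (simp add: ennreal_of_nat_eq_real_of_nat ennreal_mult[symmetric])
    then show ?thesis by (simp add: mult.assoc[symmetric])
  qed
  finally have mgf_p: "(\<integral>\<^sup>+x. exp (l * (p x - \<mu>)) \<partial>PX) \<le> ennreal (exp (l\<^sup>2 / (8 * b)))"
    using mgf by (rule order_trans)
  have "{x \<in> space PX. p x \<ge> \<mu> + t} = {x \<in> space PX. p x - \<mu> \<ge> t}"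
    by (simp add: algebra_simps)
  then have "ennreal (measure PX {x \<in> space PX. p x \<ge> \<mu> + t}) = emeasure PX {x \<in> space PX. p x - \<mu> \<ge> t}"
    by (simp add: PX.emeasure_eq_measure)
  also have "\<dots> \<le> ennreal (exp (- l * t)) * (\<integral>\<^sup>+x\<in>space PX. exp (l * (p x - \<mu>)) \<partial>PX)"
    using p_meas by (intro Chernoff_ineq_nn_integral_ge l) auto
  also have "\<dots> \<le> ennreal (exp (- l * t)) * ennreal (exp (l\<^sup>2 / (8 * b)))"
    using mgf_p by (intro mult_left_mono) (auto cong: nn_integral_cong)
  also have "\<dots> = ennreal (exp (- l * t + l\<^sup>2 / (8 * b)))"
    by (simp only: ennreal_mult[symmetric] exp_ge_zero exp_add)
  also have "- l * t + l\<^sup>2 / (8 * b) = - 2 * real b * t\<^sup>2"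
  proof -
    have "l\<^sup>2 / (8 * b) = 2 * b * t\<^sup>2" using b by (simp add: l_def power2_eq_square)
    then show ?thesis by (simp add: l_def power2_eq_square)
  qed
  finally show ?thesis
    by (simp add: \<mu>_def)
qed

end

section \<open>The fraction of bad blocks as a function of the sample\<close>

context symmetric_kernel
begin

lemma incomplete_U_cong:
  assumes "\<And>i. i \<in> vertices js \<Longrightarrow> x i = y i"
  shows "incomplete_U M h x js = incomplete_U M h y js"
proof -
  have "map (\<lambda>(i, j). h (x i) (x j)) js = map (\<lambda>(i, j). h (y i) (y j)) js"
  proof (rule map_cong[OF refl])
    fix e assume "e \<in> set js"
    then have "fst e \<in> vertices js" "snd e \<in> vertices js" by (auto simp: vertices_def)
    then show "(case e of (i, j) \<Rightarrow> h (x i) (x j)) = (case e of (i, j) \<Rightarrow> h (y i) (y j))"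
      by (simp add: case_prod_beta assms)
  qed
  then show ?thesis by (simp only: incomplete_U_def)
qed

text \<open>\<open>relabel\<close> may swap the arguments of the kernel. Symmetry undoes the swap,
  but it is assumed only on \<open>space D\<close>, so \<open>x\<close> has to lie in the product
  space.\<close>

lemma incomplete_U_relabel:
  assumes \<sigma>: "\<sigma> permutes {1..n}" and x: "x \<in> space (PiM {1..n} (\<lambda>_. D))" and js: "js \<in> blocks s n M"
  shows "incomplete_U M h (\<lambda>i\<in>{1..n}. x (\<sigma> i)) js = incomplete_U M h x (map (relabel \<sigma>) js)"
proof -
  have "map (\<lambda>(i, j). h ((\<lambda>i\<in>{1..n}. x (\<sigma> i)) i) ((\<lambda>i\<in>{1..n}. x (\<sigma> i)) j)) js
      = map (\<lambda>(i, j). h (x i) (x j)) (map (relabel \<sigma>) js)"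
  proof (simp only: map_map, rule map_cong[OF refl])
    fix e assume "e \<in> set js"
    then have "e \<in> pairs n" using js by (auto simp: blocks_def)
    then obtain i j where e: "e = (i, j)" and ij: "i \<in> {1..n}" "j \<in> {1..n}" by (auto simp: pairs_def)
    have "\<sigma> i \<in> {1..n}" "\<sigma> j \<in> {1..n}" using \<sigma> ij by (simp_all only: permutes_in_image)
    then have "x (\<sigma> i) \<in> space D" "x (\<sigma> j) \<in> space D" using x by (auto simp: space_PiM)
    then show "(case e of (i, j) \<Rightarrow> h ((\<lambda>i\<in>{1..n}. x (\<sigma> i)) i) ((\<lambda>i\<in>{1..n}. x (\<sigma> i)) j))
        = ((\<lambda>(i, j). h (x i) (x j)) \<circ> relabel \<sigma>) e"
      using ij h_sym by (simp add: e relabel_def min_def max_def)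
  qed
  then show ?thesis by (simp only: incomplete_U_def)
qed

lemma incomplete_U_measurable:
  assumes "vertices js \<subseteq> A"
  shows "(\<lambda>x. incomplete_U M h x js) \<in> borel_measurable (PiM A (\<lambda>_. D))"
proof -
  have "(\<lambda>x. \<Sum>(i, j)\<leftarrow>js. h (x i) (x j)) \<in> borel_measurable (PiM A (\<lambda>_. D))"
    using assms
  proof (induction js)
    case Nil
    then show ?case by simp
  next
    case (Cons e js)
    obtain i j where e: "e = (i, j)" by fastforce
    have "(\<lambda>x. (x i, x j)) \<in> measurable (PiM A (\<lambda>_. D)) (D \<Otimes>\<^sub>M D)"
      using Cons.prems by (intro measurable_Pair measurable_component_singleton) (auto simp: vertices_def e)
    from measurable_compose[OF this h_meas]
    show ?case using Cons by (simp add: e vertices_def)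
  qed
  then show ?thesis
    unfolding incomplete_U_def by (intro borel_measurable_scaleR borel_measurable_const)
qed

text \<open>The mean squared error bound keeps the expected bad fraction at or below \<tau> / 3, so
  a fraction of \<tau> is a deviation of at least 2 * \<tau> / 3, to which
  \<open>relabeled_average_tail\<close> applies.\<close>

lemma deviation_tail:
  fixes \<tau> r :: real
  assumes n: "2 \<le> n" and M: "0 < M" "M \<le> card (pairs n)" and b: "0 < b" "2 * M * b \<le> n"
    and \<tau>: "0 < \<tau>" and r: "0 \<le> r"
    and mse: "4 * proj_var / n + 2 * (var - 2 * proj_var) / (real n * (real n - 1)) + var / M \<le> \<tau> / 3 * r\<^sup>2"
  defines "PX \<equiv> PiM {1..n} (\<lambda>_. D)"
  shows "measure PX {x \<in> space PX.
      \<tau> \<le> real (card {js \<in> blocks s n M. r < norm (incomplete_U M h x js - mean)}) / card (blocks s n M)}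
    \<le> exp (- 2 * real b * (2 * \<tau> / 3)\<^sup>2)"
proof -
  let ?B = "blocks s n M"
  define F :: "(nat \<Rightarrow> 'z) \<Rightarrow> (nat \<times> nat) list \<Rightarrow> real"
    where "F x js = (if r < norm (incomplete_U M h x js - mean) then 1 else 0)" for x js
  define p where "p x = (\<Sum>js\<in>?B. F x js) / card ?B" for x
  interpret PX: prob_space PX unfolding PX_def by (intro prob_space_PiM prob_space_axioms)
  have cardB: "real (card ?B) > 0" using blocks_nonempty[OF M(2), of s] by (simp add: card_gt_0_iff)
  have p_eq: "p x = real (card {js \<in> ?B. r < norm (incomplete_U M h x js - mean)}) / card ?B" for x
    by (simp add: p_def F_def sum.If_cases Int_def)
  have F_meas: "(\<lambda>x. F x js) \<in> borel_measurable (PiM A (\<lambda>_. D))" if "vertices js \<subseteq> A" for js A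
  proof -
    note [measurable] = incomplete_U_measurable[OF that]
    show ?thesis unfolding F_def by measurable
  qed
  have F_PX: "(\<lambda>x. F x js) \<in> borel_measurable PX" if "js \<in> ?B" for js
    unfolding PX_def using F_meas[OF vertices_subset[OF that]] .
  have F_int: "integrable PX (\<lambda>x. F x js)" if "js \<in> ?B" for js
    using F_PX[OF that] by (intro PX.integrable_const_bound[of _ 1]) (auto simp: F_def)
  let ?mse = "\<lambda>js. \<integral>x. (norm (incomplete_U M h x js - mean))\<^sup>2 \<partial>PX"
  have mse_int: "integrable PX (\<lambda>x. (norm (incomplete_U M h x js - mean))\<^sup>2)" if "js \<in> ?B" for js
    unfolding PX_def by (rule incomplete_U_mse[OF that M(1)])
  have sum_mse: "(\<Sum>js\<in>?B. ?mse js) \<le> card ?B * (\<tau> / 3 * r\<^sup>2)"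
  proof -
    have "(\<Sum>js\<in>?B. ?mse js) \<le> card ?B *
        (4 * proj_var / n + 2 * (var - 2 * proj_var) / (real n * (real n - 1)) + var / M)"
      unfolding PX_def by (rule mean_incomplete_U_mse_le[OF n M(1)])
    also have "\<dots> \<le> card ?B * (\<tau> / 3 * r\<^sup>2)" using mse by (intro mult_left_mono) auto
    finally show ?thesis .
  qed
  have Ep: "(\<integral>x. p x \<partial>PX) \<le> \<tau> / 3"
  proof -
    have "(\<integral>x. p x \<partial>PX) = (\<Sum>js\<in>?B. \<integral>x. F x js \<partial>PX) / card ?B"
      unfolding p_def using F_int by (simp add: Bochner_Integration.integral_sum)
    moreover have "(\<Sum>js\<in>?B. \<integral>x. F x js \<partial>PX) \<le> card ?B * (\<tau> / 3)"
    \<comment> \<open>Chebyshev's inequality would divide by 0 here; instead \<open>mse\<close>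
      forces the error of every block to vanish almost surely.\<close>
    proof (cases "r = 0")
      case True
      have "?mse js = 0" if "js \<in> ?B" for js
      proof -
        have "(\<Sum>js\<in>?B. ?mse js) = 0"
          using sum_mse True by (intro antisym sum_nonneg integral_nonneg_AE) auto
        then show ?thesis using that by (subst (asm) sum_nonneg_eq_0_iff) auto
      qed
      then have "(\<integral>x. F x js \<partial>PX) = 0" if js: "js \<in> ?B" for js
      proof -
        have "AE x in PX. (norm (incomplete_U M h x js - mean))\<^sup>2 = 0"
          using \<open>\<And>js. js \<in> ?B \<Longrightarrow> ?mse js = 0\<close>[OF js]
          by (subst (asm) integral_nonneg_eq_0_iff_AE[OF mse_int[OF js]]) auto
        then have "AE x in PX. F x js = 0" by eventually_elim (simp add: F_def True)
        then show ?thesis by (rule integral_eq_zero_AE)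
      qed
      then show ?thesis using \<tau> by simp
    next
      case False
      then have r2: "r\<^sup>2 > 0" by simp
      have "(\<integral>x. F x js \<partial>PX) \<le> ?mse js / r\<^sup>2" if js: "js \<in> ?B" for js
      proof -
        have "F x js \<le> (norm (incomplete_U M h x js - mean))\<^sup>2 / r\<^sup>2" for x
          using r2 r by (auto simp: F_def pos_le_divide_eq intro!: power_mono)
        then have "(\<integral>x. F x js \<partial>PX) \<le> (\<integral>x. (norm (incomplete_U M h x js - mean))\<^sup>2 / r\<^sup>2 \<partial>PX)"
          by (intro integral_mono F_int integrable_divide mse_int js)
        then show ?thesis by simp
      qed
      then have "(\<Sum>js\<in>?B. \<integral>x. F x js \<partial>PX) \<le> (\<Sum>js\<in>?B. ?mse js) / r\<^sup>2"
        unfolding sum_divide_distrib by (rule sum_mono)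
      also have "\<dots> \<le> card ?B * (\<tau> / 3 * r\<^sup>2) / r\<^sup>2"
        using sum_mse r2 by (intro divide_right_mono) auto
      finally show ?thesis using r2 by simp
    qed
    ultimately show ?thesis
      using cardB by (simp add: pos_divide_le_eq mult.commute)
  qed
  have "measure PX {x \<in> space PX. \<tau> \<le> p x} \<le> measure PX {x \<in> space PX. p x \<ge> (\<integral>x. p x \<partial>PX) + 2 * \<tau> / 3}"
  proof (rule PX.finite_measure_mono)
    show "{x \<in> space PX. \<tau> \<le> p x} \<subseteq> {x \<in> space PX. p x \<ge> (\<integral>x. p x \<partial>PX) + 2 * \<tau> / 3}"
      using Ep by auto
    have "p \<in> borel_measurable PX"
      unfolding p_def[abs_def] using F_PX
      by (intro borel_measurable_divide borel_measurable_sum borel_measurable_const)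
    then show "{x \<in> space PX. p x \<ge> (\<integral>x. p x \<partial>PX) + 2 * \<tau> / 3} \<in> sets PX" by measurable
  qed
  also have "\<dots> \<le> exp (- 2 * real b * (2 * \<tau> / 3)\<^sup>2)"
    unfolding PX_def p_def[abs_def]
  proof (rule relabeled_average_tail)
    show "F x js = F y js" if "\<And>i. i \<in> vertices js \<Longrightarrow> x i = y i" for x y js
      using incomplete_U_cong[of js x y M, OF that] by (simp add: F_def)
    show "F (\<lambda>i\<in>{1..n}. x (\<sigma> i)) js = F x (map (relabel \<sigma>) js)"
      if "\<sigma> permutes {1..n}" "x \<in> space (PiM {1..n} (\<lambda>_. D))" "js \<in> ?B" for \<sigma> x js
      unfolding F_def incomplete_U_relabel[OF that] ..
  qed (use n M b \<tau> F_meas in \<open>auto simp: F_def\<close>)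
  finally show ?thesis by (simp only: p_eq)
qed

end

section \<open>Concentration over the blocks\<close>

text \<open>A list outside \<open>B\<close> counts as a bad vote. Such lists have probability 0, and
  the convention makes the event well behaved on the whole product space: \<open>bad\<close> is
  measurable only for members of \<open>B\<close>, and every vote that is not counted is a genuine
  block.\<close>

lemma block_votes_measurable:
  fixes K :: nat and a :: real
  assumes B: "finite B" "B \<noteq> {}" and bad: "\<And>j. j \<in> B \<Longrightarrow> {x \<in> space R. bad x j} \<in> sets R"
  defines "PJ \<equiv> PiM {1..K} (\<lambda>_. measure_pmf (pmf_of_set B))"
  shows "{z \<in> space (R \<Otimes>\<^sub>M PJ). a \<le> real (card {k\<in>{1..K}. snd z k \<notin> B \<or> bad (fst z) (snd z k)})}
    \<in> sets (R \<Otimes>\<^sub>M PJ)"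
proof -
  let ?S = "R \<Otimes>\<^sub>M PJ"
  let ?E = "\<lambda>k. {z \<in> space ?S. snd z k \<notin> B \<or> bad (fst z) (snd z k)}"
  have E: "?E k \<in> sets ?S" if k: "k \<in> {1..K}" for k
  proof -
    have "(\<lambda>z. snd z k) \<in> measurable ?S (measure_pmf (pmf_of_set B))"
      unfolding PJ_def using k by measurable
    then have coord: "{z \<in> space ?S. snd z k \<in> C} \<in> sets ?S" for C
      using measurable_sets[of "\<lambda>z. snd z k" ?S "measure_pmf (pmf_of_set B)" C]
      by (simp add: vimage_def Int_def conj_commute)
    have bad': "{z \<in> space ?S. bad (fst z) j} \<in> sets ?S" if "j \<in> B" for j
      using measurable_sets[OF measurable_fst bad[OF that], of PJ]
      by (rule back_subst) (auto simp: space_pair_measure)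
    have "{z \<in> space ?S. snd z k \<in> - B} \<union> (\<Union>j\<in>B. {z \<in> space ?S. snd z k \<in> {j}} \<inter> {z \<in> space ?S. bad (fst z) j}) \<in> sets ?S"
      using B(1) by (intro sets.Un sets.finite_UN sets.Int coord bad')
    also have "{z \<in> space ?S. snd z k \<in> - B} \<union> (\<Union>j\<in>B. {z \<in> space ?S. snd z k \<in> {j}} \<inter> {z \<in> space ?S. bad (fst z) j}) = ?E k"
      by auto
    finally show ?thesis .
  qed
  have "(\<lambda>z. \<Sum>k\<in>{1..K}. indicat_real (?E k) z) \<in> borel_measurable ?S"
    using E by (intro borel_measurable_sum borel_measurable_indicator) auto
  then have "{z \<in> space ?S. a \<le> (\<Sum>k\<in>{1..K}. indicat_real (?E k) z)} \<in> sets ?S" by measurable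
  also have "{z \<in> space ?S. a \<le> (\<Sum>k\<in>{1..K}. indicat_real (?E k) z)}
      = {z \<in> space ?S. a \<le> real (card {k\<in>{1..K}. snd z k \<notin> B \<or> bad (fst z) (snd z k)})}"
    by (intro Collect_cong conj_cong refl) (simp add: indicator_def sum.If_cases Int_def)
  finally show ?thesis .
qed

text \<open>Fubini freezes the sample. Outside \<open>T\<close> a vote is bad with probability below
  \<tau>, so \<alpha> * K bad votes exceed their mean by at least K * (\<alpha> - \<tau>) and
  Hoeffding's inequality applies; on \<open>T\<close> the conditional probability is bounded by
  1.\<close>

lemma block_votes_tail:
  fixes K :: nat and \<alpha> \<tau> :: real
  assumes R: "prob_space R" and B: "finite B" "B \<noteq> {}" and K: "0 < K" and \<tau>: "\<tau> < \<alpha>"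
    and bad: "\<And>j. j \<in> B \<Longrightarrow> {x \<in> space R. bad x j} \<in> sets R"
  defines "PJ \<equiv> PiM {1..K} (\<lambda>_. measure_pmf (pmf_of_set B))"
    and "T \<equiv> {x \<in> space R. \<tau> \<le> real (card {j\<in>B. bad x j}) / card B}"
  shows "measure (R \<Otimes>\<^sub>M PJ)
      {z \<in> space (R \<Otimes>\<^sub>M PJ). \<alpha> * K \<le> real (card {k\<in>{1..K}. snd z k \<notin> B \<or> bad (fst z) (snd z k)})}
    \<le> measure R T + exp (- 2 * K * (\<alpha> - \<tau>)\<^sup>2)" (is "measure _ ?E \<le> _")
proof -
  let ?Q = "pmf_of_set B"
  interpret R: prob_space R by fact
  interpret PJ: prob_space PJ
    unfolding PJ_def by (intro prob_space_PiM measure_pmf.prob_space_axioms)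
  interpret RJ: pair_prob_space R PJ ..
  have E: "?E \<in> sets (R \<Otimes>\<^sub>M PJ)"
    unfolding PJ_def by (rule block_votes_measurable[OF B bad])
  have cardB: "card B > 0" using B by (simp add: card_gt_0_iff)
  have T: "T \<in> sets R"
  proof -
    have "(\<lambda>x. (\<Sum>j\<in>B. indicat_real {x \<in> space R. bad x j} x) / real (card B)) \<in> borel_measurable R"
      using bad by (intro borel_measurable_divide borel_measurable_sum borel_measurable_indicator) auto
    then have "{x \<in> space R. \<tau> \<le> (\<Sum>j\<in>B. indicat_real {x \<in> space R. bad x j} x) / real (card B)} \<in> sets R"
      by measurable
    also have "{x \<in> space R. \<tau> \<le> (\<Sum>j\<in>B. indicat_real {x \<in> space R. bad x j} x) / real (card B)} = T"
      unfolding T_def using B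
      by (intro Collect_cong conj_cong refl) (simp add: indicator_def sum.If_cases Int_def)
    finally show ?thesis .
  qed
  have cond: "measure PJ (Pair x -` ?E) \<le> exp (- 2 * K * (\<alpha> - \<tau>)\<^sup>2)" if x: "x \<in> space R" "x \<notin> T" for x
  proof -
    define C where "C = {j. j \<notin> B \<or> bad x j}"
    define V where "V = (\<lambda>k (j :: nat \<Rightarrow> 'b). indicator C (j k) :: real)"
    define \<mu> where "\<mu> = (\<Sum>k\<in>{1..K}. PJ.expectation (V k))"
    have "PJ.indep_vars (\<lambda>_. measure_pmf ?Q) (\<lambda>k j. j k) {1..K}"
      unfolding PJ_def using K by (intro prob_space.indep_vars_coordinates measure_pmf.prob_space_axioms) auto
    from PJ.indep_vars_compose2[OF this, of "\<lambda>_. indicator C" "\<lambda>_. borel"]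
    have ind: "PJ.indep_vars (\<lambda>_. borel) V {1..K}" by (simp add: V_def)
    interpret H: Hoeffding_ineq PJ "{1..K}" V "\<lambda>_. 0" "\<lambda>_. 1" \<mu>
      by unfold_locales (use ind in \<open>auto simp: V_def indicator_def \<mu>_def\<close>)
    have EV: "PJ.expectation (V k) = real (card {j\<in>B. bad x j}) / card B" if k: "k \<in> {1..K}" for k
    proof -
      have m: "(\<lambda>j. j k) \<in> measurable PJ (measure_pmf ?Q)" unfolding PJ_def using k by measurable
      have "distr PJ (measure_pmf ?Q) (\<lambda>j. j k) = measure_pmf ?Q"
        unfolding PJ_def using k
        by (rule distr_PiM_component[of "{1..K}" "\<lambda>_. measure_pmf ?Q", rotated])
          (rule measure_pmf.prob_space_axioms)
      then have "PJ.expectation (V k) = (\<integral>j. indicator C j \<partial>measure_pmf ?Q)"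
        using integral_distr[OF m, of "indicator C :: _ \<Rightarrow> real"] by (simp add: V_def)
      also have "\<dots> = real (card (B \<inter> C)) / card B"
        using B by (simp add: measure_pmf_of_set)
      also have "B \<inter> C = {j\<in>B. bad x j}" by (auto simp: C_def)
      finally show ?thesis .
    qed
    have "\<mu> = K * (real (card {j\<in>B. bad x j}) / card B)" unfolding \<mu>_def using EV by simp
    also have "\<dots> \<le> K * \<tau>" using x K by (intro mult_left_mono) (auto simp: T_def)
    finally have \<mu>: "\<mu> + K * (\<alpha> - \<tau>) \<le> \<alpha> * K" by (simp add: algebra_simps)
    have "Pair x -` ?E \<subseteq> {j \<in> space PJ. (\<Sum>k\<in>{1..K}. V k j) \<ge> \<mu> + K * (\<alpha> - \<tau>)}"
    proof
      fix j assume "j \<in> Pair x -` ?E"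
      then have j: "j \<in> space PJ" "\<alpha> * K \<le> real (card {k\<in>{1..K}. j k \<notin> B \<or> bad x (j k)})"
        by (auto simp: space_pair_measure)
      have "(\<Sum>k\<in>{1..K}. V k j) = real (card {k\<in>{1..K}. j k \<notin> B \<or> bad x (j k)})"
        by (simp add: V_def C_def indicator_def sum.If_cases Int_def)
      then show "j \<in> {j \<in> space PJ. (\<Sum>k\<in>{1..K}. V k j) \<ge> \<mu> + K * (\<alpha> - \<tau>)}"
        using j \<mu> by simp
    qed
    then have "measure PJ (Pair x -` ?E) \<le> measure PJ {j \<in> space PJ. (\<Sum>k\<in>{1..K}. V k j) \<ge> \<mu> + K * (\<alpha> - \<tau>)}"
      by (intro PJ.finite_measure_mono) measurable
    also have "\<dots> \<le> exp (- 2 * (K * (\<alpha> - \<tau>))\<^sup>2 / (\<Sum>k\<in>{1..K}. (1 - 0)\<^sup>2))"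
      using K \<tau> by (intro H.Hoeffding_ineq_ge) auto
    also have "- 2 * (K * (\<alpha> - \<tau>))\<^sup>2 / (\<Sum>k\<in>{1..K}. (1 - 0)\<^sup>2) = - 2 * K * (\<alpha> - \<tau>)\<^sup>2"
      using K by (simp add: power2_eq_square)
    finally show ?thesis .
  qed
  have "emeasure (R \<Otimes>\<^sub>M PJ) ?E = (\<integral>\<^sup>+x. emeasure PJ (Pair x -` ?E) \<partial>R)"
    by (rule PJ.emeasure_pair_measure_alt[OF E])
  also have "\<dots> \<le> (\<integral>\<^sup>+x. indicator T x + ennreal (exp (- 2 * K * (\<alpha> - \<tau>)\<^sup>2)) \<partial>R)"
  proof (intro nn_integral_mono)
    fix x assume x: "x \<in> space R"
    show "emeasure PJ (Pair x -` ?E) \<le> indicator T x + ennreal (exp (- 2 * K * (\<alpha> - \<tau>)\<^sup>2))"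
    proof (cases "x \<in> T")
      case True
      have "emeasure PJ (Pair x -` ?E) \<le> 1" by (rule PJ.measure_le_1)
      also have "\<dots> \<le> indicator T x + ennreal (exp (- 2 * K * (\<alpha> - \<tau>)\<^sup>2))"
        using True by simp
      finally show ?thesis .
    next
      case False
      then show ?thesis
        using ennreal_leI[OF cond[OF x]] by (simp add: PJ.emeasure_eq_measure)
    qed
  qed
  also have "\<dots> = ennreal (measure R T + exp (- 2 * K * (\<alpha> - \<tau>)\<^sup>2))"
    using T by (subst nn_integral_add) (auto simp: R.emeasure_eq_measure R.prob_space)
  finally show ?thesis
    by (simp only: RJ.P.emeasure_eq_measure ennreal_le_iff add_nonneg_nonneg measure_nonneg exp_ge_zero)
qed

section \<open>Transfer to the sample space\<close>

text \<open>Product measures are determined by rectangles, whose two preimages lie in the two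
  generated sigma-algebras.\<close>

lemma (in prob_space) distr_Pair_eq_of_indep_set:
  assumes X: "X \<in> measurable M S" and Y: "Y \<in> measurable M T"
    and ind: "indep_set (sets (vimage_algebra (space M) X S)) (sets (vimage_algebra (space M) Y T))"
  shows "distr M (S \<Otimes>\<^sub>M T) (\<lambda>\<omega>. (X \<omega>, Y \<omega>)) = distr M S X \<Otimes>\<^sub>M distr M T Y"
proof (rule pair_measure_eqI[symmetric])
  show "sigma_finite_measure (distr M S X)" "sigma_finite_measure (distr M T Y)"
    using X Y by (auto intro!: prob_space_imp_sigma_finite prob_space_distr)
  show "sets (distr M S X \<Otimes>\<^sub>M distr M T Y) = sets (distr M (S \<Otimes>\<^sub>M T) (\<lambda>\<omega>. (X \<omega>, Y \<omega>)))"
    by (simp cong: sets_pair_measure_cong)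
  fix A B assume "A \<in> sets (distr M S X)" "B \<in> sets (distr M T Y)"
  then have AB: "A \<in> sets S" "B \<in> sets T" by auto
  let ?A = "X -` A \<inter> space M" and ?B = "Y -` B \<inter> space M"
  have "?A \<in> sets (vimage_algebra (space M) X S)" "?B \<in> sets (vimage_algebra (space M) Y T)"
    using AB by (auto intro: in_vimage_algebra)
  then have "prob (?A \<inter> ?B) = prob ?A * prob ?B" by (rule indep_setD[OF ind])
  moreover have "(\<lambda>\<omega>. (X \<omega>, Y \<omega>)) -` (A \<times> B) \<inter> space M = ?A \<inter> ?B" by auto
  moreover have "(\<lambda>\<omega>. (X \<omega>, Y \<omega>)) \<in> measurable M (S \<Otimes>\<^sub>M T)" using X Y by (rule measurable_Pair)
  ultimately show "emeasure (distr M S X) A * emeasure (distr M T Y) B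
      = emeasure (distr M (S \<Otimes>\<^sub>M T) (\<lambda>\<omega>. (X \<omega>, Y \<omega>))) (A \<times> B)"
    using AB X Y by (simp add: emeasure_distr emeasure_eq_measure ennreal_mult)
qed

lemma (in prob_space) finite_measure_subalgebra_vimage:
  assumes "X \<in> measurable M N"
  shows "finite_measure_subalgebra M (vimage_algebra (space M) X N)"
  by unfold_locales
    (auto simp: subalgebra_def sets_vimage_algebra2 measurable_space[OF assms] intro: measurable_sets[OF assms])

text \<open>The freezing rule: conditioning on \<open>X\<close> integrates out the independent
  second argument. Sets of the generated sigma-algebra are preimages under \<open>X\<close>, so the
  defining identity is Fubini's theorem with an indicator of the first coordinate.\<close>

lemma (in prob_space) real_cond_exp_kernel:
  fixes \<phi> :: "'b \<Rightarrow> 'b \<Rightarrow> real"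
  assumes X [measurable]: "X \<in> measurable M N" and Y [measurable]: "Y \<in> measurable M N"
    and D: "D = distr M N X"
    and law: "distr M (N \<Otimes>\<^sub>M N) (\<lambda>\<omega>. (X \<omega>, Y \<omega>)) = D \<Otimes>\<^sub>M D"
    and \<phi>: "integrable (D \<Otimes>\<^sub>M D) (\<lambda>(x, y). \<phi> x y)"
  shows "AE \<omega> in M. real_cond_exp M (vimage_algebra (space M) X N) (\<lambda>\<omega>. \<phi> (X \<omega>) (Y \<omega>)) \<omega>
    = (\<integral>y. \<phi> (X \<omega>) y \<partial>D)"
proof -
  let ?F = "vimage_algebra (space M) X N"
  let ?\<psi> = "\<lambda>x. \<integral>y. \<phi> x y \<partial>D"
  interpret D: prob_space D unfolding D by (rule prob_space_distr) simp
  interpret DD: pair_prob_space D D ..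
  have sD [measurable_cong]: "sets D = sets N" by (simp add: D)
  interpret finite_measure_subalgebra M ?F by (rule finite_measure_subalgebra_vimage[OF X])
  have \<phi>m [measurable]: "(\<lambda>(x, y). \<phi> x y) \<in> borel_measurable (N \<Otimes>\<^sub>M N)"
    using borel_measurable_integrable[OF \<phi>] by (simp cong: measurable_cong_sets sets_pair_measure_cong add: sD)
  have XY [measurable]: "(\<lambda>\<omega>. (X \<omega>, Y \<omega>)) \<in> measurable M (N \<Otimes>\<^sub>M N)" by measurable
  have int_fst: "integrable D ?\<psi>" using DD.integrable_fst'[OF \<phi>] by simp
  have \<psi>m: "?\<psi> \<in> borel_measurable N"
    using borel_measurable_integrable[OF int_fst] by (simp cong: measurable_cong_sets add: sD)
  show ?thesis
  proof (rule real_cond_exp_charact)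
    show "integrable M (\<lambda>\<omega>. \<phi> (X \<omega>) (Y \<omega>))"
      using integrable_distr[OF XY, of "\<lambda>(x, y). \<phi> x y"] \<phi> by (simp add: law)
    show "integrable M (\<lambda>\<omega>. ?\<psi> (X \<omega>))"
      using integrable_distr[OF X, of ?\<psi>] int_fst by (simp add: D)
    show "(\<lambda>\<omega>. ?\<psi> (X \<omega>)) \<in> borel_measurable ?F"
      using \<psi>m by (rule measurable_compose[rotated]) (simp add: measurable_vimage_algebra1 measurable_space[OF X] Pi_def)
    fix A assume "A \<in> sets ?F"
    then obtain B where B: "B \<in> sets N" "A = X -` B \<inter> space M"
      by (auto simp: sets_vimage_algebra2 measurable_space[OF X])
    have ind: "indicator A \<omega> = (indicator B (X \<omega>) :: real)" if "\<omega> \<in> space M" for \<omega>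
      using that B by (auto simp: indicator_def)
    have Bm [measurable]: "B \<in> sets D" using B sD by simp
    let ?G = "\<lambda>(x, y). indicator B x * \<phi> x y"
    have Gm: "?G \<in> borel_measurable (N \<Otimes>\<^sub>M N)"
      using B by measurable
    have Gi: "integrable (D \<Otimes>\<^sub>M D) ?G"
    proof (rule Bochner_Integration.integrable_bound[OF \<phi>])
      show "?G \<in> borel_measurable (D \<Otimes>\<^sub>M D)"
        using Gm by (simp cong: measurable_cong_sets sets_pair_measure_cong add: sD)
    qed (auto simp: indicator_def)
    have "(\<integral>\<omega>\<in>A. \<phi> (X \<omega>) (Y \<omega>) \<partial>M) = (\<integral>\<omega>. ?G (X \<omega>, Y \<omega>) \<partial>M)"
      unfolding set_lebesgue_integral_def
      by (intro Bochner_Integration.integral_cong) (simp_all add: ind)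
    also have "\<dots> = integral\<^sup>L (D \<Otimes>\<^sub>M D) ?G"
      unfolding law[symmetric] by (rule integral_distr[OF XY Gm, symmetric])
    also have "\<dots> = (\<integral>x. indicator B x * ?\<psi> x \<partial>D)"
      using DD.integral_fst'[OF Gi] by simp
    also have "\<dots> = (\<integral>\<omega>. indicator B (X \<omega>) * ?\<psi> (X \<omega>) \<partial>M)"
    proof -
      have "(\<lambda>x. indicator B x * ?\<psi> x) \<in> borel_measurable N" using B(1) \<psi>m by measurable
      from integral_distr[OF X this] show ?thesis unfolding D .
    qed
    also have "\<dots> = (\<integral>\<omega>\<in>A. ?\<psi> (X \<omega>) \<partial>M)"
      unfolding set_lebesgue_integral_def
      by (intro Bochner_Integration.integral_cong) (simp_all add: ind)
    finally show "(\<integral>\<omega>\<in>A. \<phi> (X \<omega>) (Y \<omega>) \<partial>M) = (\<integral>\<omega>\<in>A. ?\<psi> (X \<omega>) \<partial>M)" .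
  qed
qed

section \<open>Identification of the moments on the probability space with those of the
  kernel\<close>

lemma trace_cov_matrix:
  "trace (cov_matrix P Y) = (\<Sum>c\<in>UNIV. \<integral>\<omega>. (Y \<omega> $ c - (\<integral>\<omega>. Y \<omega> $ c \<partial>P))\<^sup>2 \<partial>P)"
  by (simp add: trace_def cov_matrix_def power2_eq_square)

lemma (in prob_space) two_sample_moments:
  fixes X :: "nat \<Rightarrow> 'a \<Rightarrow> 'z" and h :: "'z \<Rightarrow> 'z \<Rightarrow> real ^ 'd"
  assumes X1: "X 1 \<in> measurable M N" and X2: "X 2 \<in> measurable M N"
    and D: "D = distr M N (X 1)"
    and law: "distr M (N \<Otimes>\<^sub>M N) (\<lambda>\<omega>. (X 1 \<omega>, X 2 \<omega>)) = D \<Otimes>\<^sub>M D"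
    and kernel: "symmetric_kernel D h"
  shows "Theta M X h = symmetric_kernel.mean D h"
    and "zeta_sq M X h = symmetric_kernel.var D h"
    and "zeta1_sq M N X h = symmetric_kernel.proj_var D h"
proof -
  interpret SK: symmetric_kernel D h by fact
  let ?X = "\<lambda>\<omega>. (X 1 \<omega>, X 2 \<omega>)"
  have XX: "?X \<in> measurable M (N \<Otimes>\<^sub>M N)" using X1 X2 by (rule measurable_Pair)
  have sD: "sets (D \<Otimes>\<^sub>M D) = sets (N \<Otimes>\<^sub>M N)" by (intro sets_pair_measure_cong) (simp_all add: D)
  have trans: "(\<integral>\<omega>. g (X 1 \<omega>) (X 2 \<omega>) \<partial>M) = (\<integral>(x, y). g x y \<partial>(D \<Otimes>\<^sub>M D))"
    if "(\<lambda>(x, y). g x y) \<in> borel_measurable (D \<Otimes>\<^sub>M D)"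
    for g :: "'z \<Rightarrow> 'z \<Rightarrow> 'e::{banach, second_countable_topology}"
  proof -
    have "(\<lambda>(x, y). g x y) \<in> borel_measurable (N \<Otimes>\<^sub>M N)"
      using that by (simp cong: measurable_cong_sets add: sD)
    from integral_distr[OF XX this] show ?thesis unfolding law by simp
  qed
  show "Theta M X h = SK.mean"
    unfolding Theta_def SK.mean_def by (rule trans[OF SK.h_meas])
  have comp: "(\<integral>\<omega>. h (X 1 \<omega>) (X 2 \<omega>) $ c \<partial>M) = SK.mean $ c" for c
    by (subst trans[OF SK.component_meas]) (rule SK.component_integral)
  have "(\<integral>\<omega>. (SK.centered c (X 1 \<omega>) (X 2 \<omega>))\<^sup>2 \<partial>M) = (\<integral>(x, y). (SK.centered c x y)\<^sup>2 \<partial>(D \<Otimes>\<^sub>M D))" for c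
    by (rule trans[OF borel_measurable_integrable[OF SK.centered_square_integrable]])
  then show "zeta_sq M X h = SK.var"
    unfolding zeta_sq_def trace_cov_matrix SK.var_def comp by (simp add: SK.centered_def)
  let ?F = "vimage_algebra (space M) (X 1) N"
  let ?Y = "\<lambda>c \<omega>. h (X 1 \<omega>) (X 2 \<omega>) $ c"
  interpret finite_measure_subalgebra M ?F by (rule finite_measure_subalgebra_vimage[OF X1])
  have Y_int: "integrable M (?Y c)" for c
    using integrable_distr[OF XX, of "\<lambda>(x, y). h x y $ c"] SK.component_integrable[of c] unfolding law by simp
  have "(\<integral>\<omega>. (real_cond_exp M ?F (?Y c) \<omega> - (\<integral>\<omega>. real_cond_exp M ?F (?Y c) \<omega> \<partial>M))\<^sup>2 \<partial>M)
      = (\<integral>x. (\<integral>y. SK.centered c x y \<partial>D)\<^sup>2 \<partial>D)" for c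
  proof -
    let ?g = "\<lambda>x. \<integral>y. SK.centered c x y \<partial>D"
    have g: "?g \<in> borel_measurable D"
      using SK.centered_meas[of c] by measurable
    have E: "(\<integral>\<omega>. real_cond_exp M ?F (?Y c) \<omega> \<partial>M) = SK.mean $ c"
      using real_cond_exp_int(2)[OF Y_int[of c]] comp by simp
    \<comment> \<open>The integral of the centered section splits only where the section of
      \<open>h\<close> is integrable, which is almost everywhere.\<close>
    have "AE x in D. ?g x = (\<integral>y. h x y $ c \<partial>D) - SK.mean $ c"
      using SK.DD.AE_integrable_fst'[OF SK.component_integrable[of c]]
    proof eventually_elim
      case (elim x)
      then show ?case
        unfolding SK.centered_def by (subst Bochner_Integration.integral_diff) (auto simp: SK.prob_space)
    qed
    then have "AE \<omega> in M. ?g (X 1 \<omega>) = (\<integral>y. h (X 1 \<omega>) y $ c \<partial>D) - SK.mean $ c"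
      unfolding D by (rule AE_distrD[OF X1])
    moreover have "AE \<omega> in M. real_cond_exp M ?F (?Y c) \<omega> = (\<integral>y. h (X 1 \<omega>) y $ c \<partial>D)"
      by (rule real_cond_exp_kernel[OF X1 X2 D law SK.component_integrable])
    ultimately have "AE \<omega> in M. (real_cond_exp M ?F (?Y c) \<omega> - SK.mean $ c)\<^sup>2 = (?g (X 1 \<omega>))\<^sup>2"
      by eventually_elim simp
    moreover have gN: "?g \<in> borel_measurable N"
      using g by (simp add: D)
    ultimately have "(\<integral>\<omega>. (real_cond_exp M ?F (?Y c) \<omega> - SK.mean $ c)\<^sup>2 \<partial>M) = (\<integral>\<omega>. (?g (X 1 \<omega>))\<^sup>2 \<partial>M)"
      by (intro integral_cong_AE borel_measurable_power borel_measurable_diff borel_measurable_cond_exp2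
          borel_measurable_const measurable_compose[OF X1])
    also have "\<dots> = (\<integral>x. (?g x)\<^sup>2 \<partial>D)"
      using integral_distr[OF X1 borel_measurable_power[OF gN]] by (simp add: D)
    finally show ?thesis unfolding E .
  qed
  then show "zeta1_sq M N X h = SK.proj_var"
    unfolding zeta1_sq_def trace_cov_matrix SK.proj_var_def vec_cond_exp_def by simp
qed

text \<open>\<open>M\<close> balances two demands: small enough that n div (2 * M) windows give the
  tail \<delta> / 2, large enough that 1 / M adds at most 9 * L / (n * \<tau>^2) to the
  error.\<close>

lemma parameter_bounds:
  fixes \<delta> \<alpha> \<tau> :: real and n K M :: nat
  defines "L \<equiv> ln (2 / \<delta>)"
  assumes \<delta>: "0 < \<delta>" "\<delta> < 1" and \<tau>: "0 < \<tau>" "\<tau> < \<alpha>" "\<alpha> < 1 / 2" and "0 < M"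
    and n: "real n \<ge> 9 * L / (2 * \<tau>\<^sup>2)" and K: "real K \<ge> L / (2 * (\<alpha> - \<tau>)\<^sup>2)"
    and M: "int M = \<lfloor>2 * real n * \<tau>\<^sup>2 / (9 * L)\<rfloor>"
  shows "L > 0" "2 \<le> n" "M \<le> card (pairs n)" "2 * M \<le> n"
    and "1 / real M \<le> 9 * L / (real n * \<tau>\<^sup>2)"
    and "exp (- 2 * real (n div (2 * M)) * (2 * \<tau> / 3)\<^sup>2) \<le> \<delta> / 2"
    and "exp (- 2 * K * (\<alpha> - \<tau>)\<^sup>2) \<le> \<delta> / 2"
proof -
  \<comment> \<open>The crude bounds L > ln 2 >= 2 / 3 and \<tau>^2 < 1 / 4 suffice for n > 12 and
    12 * y <= n, which make room for the blocks.\<close>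
  have "ln 2 < L" unfolding L_def using \<delta> by (subst ln_less_cancel_iff) (auto simp: field_simps)
  then have L: "L > 2 / 3" using ln2_ge_two_thirds by linarith
  then show L0: "L > 0" by simp
  have \<delta>L: "exp (- L) = \<delta> / 2" unfolding L_def using \<delta> by (simp add: exp_minus)
  have t2: "\<tau>\<^sup>2 < (1 / 2)\<^sup>2" using \<tau> by (intro power_strict_mono) auto
  then have t4: "\<tau>\<^sup>2 < 1 / 4" by (simp add: power2_eq_square)
  have tp: "0 < \<tau>\<^sup>2" using \<tau> by simp
  have "9 * L \<le> real n * (2 * \<tau>\<^sup>2)" using n tp by (simp add: pos_divide_le_eq)
  also have "\<dots> \<le> real n * (2 * (1 / 4))" using t4 by (intro mult_left_mono) auto
  finally have n12: "12 < real n" using L by linarith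
  then show n2: "2 \<le> n" by linarith
  define y where "y = 2 * real n * \<tau>\<^sup>2 / (9 * L)"
  have My: "real M \<le> y" "y < real M + 1"
    using M unfolding y_def[symmetric] by linarith+
  have "y * (9 * L) = 2 * real n * \<tau>\<^sup>2" using L0 by (simp add: y_def)
  also have "\<dots> \<le> 2 * real n * (1 / 4)" using t4 by (intro mult_left_mono) auto
  finally have "y * (9 * L) \<le> real n / 2" by simp
  moreover have "y * 6 \<le> y * (9 * L)" using L My by (intro mult_left_mono) auto
  ultimately have yn: "12 * y \<le> real n" by linarith
  then show Mn: "2 * M \<le> n" using My by linarith
  have "real M \<le> real n" using Mn by linarith
  also have "real n * 2 \<le> real n * (real n - 1)" using n12 by (intro mult_left_mono) auto
  then have "real n \<le> real (card (pairs n))" by (simp add: real_card_pairs)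
  finally show "M \<le> card (pairs n)" by simp
  \<comment> \<open>As \<open>M\<close> is at least 1, rounding \<open>y\<close> down loses at most
    a factor 2.\<close>
  have "y \<le> 2 * real M" using My \<open>0 < M\<close> by linarith
  then have y2: "2 * real n * \<tau>\<^sup>2 \<le> 2 * real M * (9 * L)" using L0 by (simp add: y_def pos_divide_le_eq)
  then show "1 / real M \<le> 9 * L / (real n * \<tau>\<^sup>2)"
    using \<open>0 < M\<close> n2 tp by (simp add: divide_simps mult_ac)
  define b where "b = n div (2 * M)"
  have "n < 2 * M * (b + 1)"
    using dividend_less_div_times[of "2 * M" n] \<open>0 < M\<close> by (simp add: b_def algebra_simps)
  \<comment> \<open>In the same way b + 1 <= 2 * b absorbs the rounding of n div (2 * M). Together
    with M <= y this yields 9 * L <= 8 * b * \<tau>^2, which is what the exponent requires.\<close>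
  moreover have b1: "1 \<le> b" using Mn \<open>0 < M\<close> by (simp add: b_def div_greater_zero_iff Suc_le_eq)
  then have "2 * M * (b + 1) \<le> 2 * M * (2 * b)" by (intro mult_left_mono) auto
  ultimately have "n \<le> 4 * M * b" by linarith
  then have "real n \<le> 4 * real M * real b"
    by (metis of_nat_le_iff of_nat_mult of_nat_numeral)
  moreover have "real M * (9 * L) \<le> 2 * real n * \<tau>\<^sup>2"
    using My(1) L0 by (simp add: y_def pos_le_divide_eq)
  ultimately have "real M * (9 * L) \<le> 2 * (4 * real M * real b) * \<tau>\<^sup>2"
    by (smt (verit) mult_left_mono mult_right_mono zero_le_power2)
  then have "real M * (9 * L) \<le> real M * (8 * real b * \<tau>\<^sup>2)" by (simp add: mult_ac)
  then have "9 * L \<le> 8 * real b * \<tau>\<^sup>2" using \<open>0 < M\<close> by simp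
  then have "- 2 * real b * (2 * \<tau> / 3)\<^sup>2 \<le> - L" by (simp add: power_divide power_mult_distrib)
  then show "exp (- 2 * real (n div (2 * M)) * (2 * \<tau> / 3)\<^sup>2) \<le> \<delta> / 2"
    unfolding \<delta>L[symmetric] b_def[symmetric] by simp
  have "L \<le> K * (2 * (\<alpha> - \<tau>)\<^sup>2)" using K \<tau> by (simp add: pos_divide_le_eq)
  then show "exp (- 2 * K * (\<alpha> - \<tau>)\<^sup>2) \<le> \<delta> / 2"
    unfolding \<delta>L[symmetric] by (simp add: mult_ac)
qed

theorem theorem3p4:
  fixes P :: "'w measure" and N :: "'z measure"
    and X :: "nat \<Rightarrow> 'w \<Rightarrow> 'z"
    and J :: "nat \<Rightarrow> 'w \<Rightarrow> (nat \<times> nat) list"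
    and h :: "'z \<Rightarrow> 'z \<Rightarrow> real ^ 'd"
    and \<Theta>hat :: "'w \<Rightarrow> real ^ 'd"
    and \<delta> \<alpha> \<tau> C\<^sub>\<alpha> :: real and n K M :: nat
    and scheme :: sampling
  assumes P: "prob_space P"
    and delta: "0 < \<delta>" "\<delta> < 1"
    and alpha: "0 < \<alpha>" "\<alpha> < 1 / 2"
    and tau: "0 < \<tau>" "\<tau> < \<alpha>"
    and C_alpha: "C\<^sub>\<alpha> = (1 - \<alpha>) / sqrt (1 - 2 * \<alpha>)"
    and pos: "0 < n" "0 < K" "0 < M"
    and n: "real n \<ge> 9 * ln (2 / \<delta>) / (2 * \<tau>\<^sup>2)"
    and K: "real K \<ge> ln (2 / \<delta>) / (2 * (\<alpha> - \<tau>)\<^sup>2)"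
    and M: "int M = \<lfloor>2 * real n * \<tau>\<^sup>2 / (9 * ln (2 / \<delta>))\<rfloor>"
    and X_indep: "prob_space.indep_vars P (\<lambda>_. N) X {1..n}"
    and X_ident: "\<And>i. i \<in> {1..n} \<Longrightarrow> distr P N (X i) = distr P N (X 1)"
    and h_meas: "(\<lambda>(x, y). h x y) \<in> borel_measurable (N \<Otimes>\<^sub>M N)"
    and h_sym: "\<And>x y. x \<in> space N \<Longrightarrow> y \<in> space N \<Longrightarrow> h x y = h y x"
    and h_sq: "integrable P (\<lambda>\<omega>. (norm (h (X 1 \<omega>) (X 2 \<omega>)))\<^sup>2)"
    and J_indep: "prob_space.indep_vars P (\<lambda>_. count_space UNIV) J {1..K}"
    and J_law: "\<And>k. k \<in> {1..K} \<Longrightarrow>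
          distr P (count_space UNIV) (J k) = measure_pmf (block_pmf scheme n M)"
    and XJ_indep: "prob_space.indep_set P
          (sets (vimage_algebra (space P) (\<lambda>\<omega>. \<lambda>i\<in>{1..n}. X i \<omega>) (Pi\<^sub>M {1..n} (\<lambda>_. N))))
          (sets (vimage_algebra (space P) (\<lambda>\<omega>. \<lambda>k\<in>{1..K}. J k \<omega>)
            (Pi\<^sub>M {1..K} (\<lambda>_. count_space UNIV))))"
    and \<Theta>hat: "\<And>\<omega>. \<omega> \<in> space P \<Longrightarrow>
          is_geometric_median K (\<lambda>k. incomplete_U M h (\<lambda>i. X i \<omega>) (J k \<omega>)) (\<Theta>hat \<omega>)"
  shows
    \<comment> \<open>Phrased with an event inside the bound, since \<open>\<Theta>hat\<close> is an arbitrary, possibly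
      nonmeasurable, selection from the set of minimizers.\<close>
    "\<exists>A \<in> sets P. measure P A \<ge> 1 - \<delta> \<and>
       (\<forall>\<omega>\<in>A. norm (\<Theta>hat \<omega> - Theta P X h)
         \<le> C\<^sub>\<alpha> * sqrt (12 * zeta1_sq P N X h / (real n * \<tau>)
                  + 6 * zeta2_sq P N X h / (\<tau> * real n * (real n - 1))
                  + 27 * zeta_sq P X h * ln (2 / \<delta>) / (real n * \<tau> ^ 3)))"
proof -
  interpret P: prob_space P by fact
  define L where "L = ln (2 / \<delta>)"
  note bounds = parameter_bounds[OF delta tau alpha(2) pos(3) n K M, folded L_def]
  have n2: "2 \<le> n" by (rule bounds(2))

  \<comment> \<open>Joint law of the sample and of the blocks\<close>
  let ?I = "{1..n}"
  define D where "D = distr P N (X 1)"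
  define PX where "PX = PiM ?I (\<lambda>_. D)"
  define B where "B = blocks scheme n M"
  define PJ where "PJ = PiM {1..K} (\<lambda>_. measure_pmf (pmf_of_set B))"
  define Xr where "Xr \<omega> = (\<lambda>i\<in>?I. X i \<omega>)" for \<omega>
  define Jr where "Jr \<omega> = (\<lambda>k\<in>{1..K}. J k \<omega>)" for \<omega>
  have B: "finite B" "B \<noteq> {}" using blocks_nonempty[OF bounds(3)] by (simp_all add: B_def)
  have pairs_ne: "pairs n \<noteq> {}" using bounds(3) pos(3) by auto
  have X_rv: "X i \<in> measurable P N" if "i \<in> ?I" for i
    using X_indep that by (simp add: P.indep_vars_def)
  have J_rv: "J k \<in> measurable P (count_space UNIV)" if "k \<in> {1..K}" for k
    using J_indep that by (simp add: P.indep_vars_def)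
  have X1: "X 1 \<in> measurable P N" and X2: "X 2 \<in> measurable P N" using X_rv n2 by auto
  interpret D: prob_space D unfolding D_def by (rule P.prob_space_distr[OF X1])
  have sD: "sets D = sets N" by (simp add: D_def)
  have sDD: "sets (D \<Otimes>\<^sub>M D) = sets (N \<Otimes>\<^sub>M N)" by (intro sets_pair_measure_cong) (simp_all add: sD)
  have sPX: "sets (PiM A (\<lambda>_. N)) = sets (PiM A (\<lambda>_. D))" for A :: "nat set"
    by (intro sets_PiM_cong) (simp_all add: sD)
  have Xr: "Xr \<in> measurable P (PiM ?I (\<lambda>_. N))"
    unfolding Xr_def[abs_def] using X_rv by (intro measurable_restrict) auto
  have Jr: "Jr \<in> measurable P (PiM {1..K} (\<lambda>_. count_space UNIV))"
    unfolding Jr_def[abs_def] using J_rv by (intro measurable_restrict) auto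
  have law_X: "distr P (PiM ?I (\<lambda>_. N)) Xr = PX"
  proof -
    have "distr P (PiM ?I (\<lambda>_. N)) Xr = PiM ?I (\<lambda>i. distr P N (X i))"
      unfolding Xr_def[abs_def] using X_indep X_rv n2
      by (subst P.indep_vars_iff_distr_eq_PiM'[symmetric]) auto
    also have "\<dots> = PX"
      unfolding PX_def D_def by (intro PiM_cong refl X_ident)
    finally show ?thesis .
  qed
  have law_J: "distr P (PiM {1..K} (\<lambda>_. count_space UNIV)) Jr = PJ"
  proof -
    have "distr P (PiM {1..K} (\<lambda>_. count_space UNIV)) Jr = PiM {1..K} (\<lambda>k. distr P (count_space UNIV) (J k))"
      unfolding Jr_def[abs_def] using J_indep J_rv pos(2)
      by (subst P.indep_vars_iff_distr_eq_PiM'[symmetric]) auto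
    also have "\<dots> = PJ"
      unfolding PJ_def B_def block_pmf_eq[OF pairs_ne, symmetric] by (intro PiM_cong refl J_law)
    finally show ?thesis .
  qed
  have law_XJ: "distr P (PiM ?I (\<lambda>_. N) \<Otimes>\<^sub>M PiM {1..K} (\<lambda>_. count_space UNIV)) (\<lambda>\<omega>. (Xr \<omega>, Jr \<omega>)) = PX \<Otimes>\<^sub>M PJ"
    unfolding law_X[symmetric] law_J[symmetric]
    by (rule P.distr_Pair_eq_of_indep_set[OF Xr Jr]) (use XJ_indep in \<open>simp add: Xr_def[abs_def] Jr_def[abs_def]\<close>)
  have law_12: "distr P (N \<Otimes>\<^sub>M N) (\<lambda>\<omega>. (X 1 \<omega>, X 2 \<omega>)) = D \<Otimes>\<^sub>M D"
  proof -
    have m: "(\<lambda>x. (x 1, x 2)) \<in> measurable (PiM ?I (\<lambda>_. N)) (N \<Otimes>\<^sub>M N)"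
      using n2 by (intro measurable_Pair measurable_component_singleton) auto
    have "D \<Otimes>\<^sub>M D = distr PX (D \<Otimes>\<^sub>M D) (\<lambda>x. (x 1, x 2))"
      unfolding PX_def using n2 by (intro D.distr_PiM_two_coordinates[symmetric]) auto
    also have "\<dots> = distr PX (N \<Otimes>\<^sub>M N) (\<lambda>x. (x 1, x 2))"
      by (intro distr_cong refl sDD)
    also have "\<dots> = distr P (N \<Otimes>\<^sub>M N) (\<lambda>\<omega>. (X 1 \<omega>, X 2 \<omega>))"
      unfolding law_X[symmetric] using n2 by (subst distr_distr[OF m Xr]) (simp add: comp_def Xr_def)
    finally show ?thesis ..
  qed
  have hD: "(\<lambda>(x, y). h x y) \<in> borel_measurable (D \<Otimes>\<^sub>M D)"
    using h_meas by (simp cong: measurable_cong_sets add: sDD)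
  interpret symmetric_kernel D h
  proof unfold_locales
    show "(\<lambda>(x, y). h x y) \<in> borel_measurable (D \<Otimes>\<^sub>M D)" by (rule hD)
    show "h x y = h y x" if "x \<in> space D" "y \<in> space D" for x y
      using that by (intro h_sym) (simp_all add: D_def)
    have XX: "(\<lambda>\<omega>. (X 1 \<omega>, X 2 \<omega>)) \<in> measurable P (N \<Otimes>\<^sub>M N)" using X1 X2 by (rule measurable_Pair)
    have "(\<lambda>p. (norm ((\<lambda>(x, y). h x y) p))\<^sup>2) \<in> borel_measurable (N \<Otimes>\<^sub>M N)" using h_meas by measurable
    then have "(\<lambda>(x, y). (norm (h x y))\<^sup>2) \<in> borel_measurable (N \<Otimes>\<^sub>M N)" by (simp add: case_prod_beta')
    from integrable_distr_eq[OF XX this] h_sq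
    show "integrable (D \<Otimes>\<^sub>M D) (\<lambda>(x, y). (norm (h x y))\<^sup>2)" unfolding law_12 by simp
  qed
  note moments = P.two_sample_moments[OF X1 X2 D_def law_12 symmetric_kernel_axioms]
  \<comment> \<open>\<tau> / 3 * t is the mean squared error bound with 1 / M replaced by 9 * L / (n
    * \<tau>^2), as \<open>deviation_tail\<close> requires of r^2.\<close>
  define t where "t = 12 * proj_var / (real n * \<tau>)
    + 6 * (var - 2 * proj_var) / (\<tau> * real n * (real n - 1)) + 27 * var * L / (real n * \<tau> ^ 3)"
  define r where "r = sqrt t"
  have mse_t: "4 * proj_var / n + 2 * (var - 2 * proj_var) / (real n * (real n - 1)) + var / M \<le> \<tau> / 3 * t"
  proof -
    have var: "0 \<le> var" using proj_var_nonneg proj_var_le_var by simp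
    have cancel: "\<tau> / 3 * (6 * w / (\<tau> * a * b)) = 2 * w / (a * b)" for w a b :: real
      using tau(1) by simp
    have "\<tau> / 3 * (12 * proj_var / (real n * \<tau>)) = 4 * proj_var / n"
      "\<tau> / 3 * (27 * var * L / (real n * \<tau> ^ 3)) = var * (9 * L / (real n * \<tau>\<^sup>2))"
      using tau(1) by (simp_all add: power2_eq_square power3_eq_cube)
    note this cancel[of "var - 2 * proj_var" "real n" "real n - 1"]
    moreover have "var / M \<le> var * (9 * L / (real n * \<tau>\<^sup>2))"
      using mult_left_mono[OF bounds(5) var] by simp
    ultimately show ?thesis unfolding t_def by (simp only: distrib_left)
  qed
  \<comment> \<open>The sign of \<open>var - 2 * proj_var\<close> is left open: over a common
    denominator the first two terms have the nonnegative coefficients 4 * (n - 2) and 2.\<close>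
  have "0 \<le> \<tau> / 3 * t"
  proof -
    have "4 * proj_var / n + 2 * (var - 2 * proj_var) / (real n * (real n - 1))
        = (4 * (real n - 2) * proj_var + 2 * var) / (real n * (real n - 1))"
      using n2 by (simp add: field_simps)
    also have "\<dots> \<ge> 0"
      using n2 proj_var_nonneg proj_var_le_var by (intro divide_nonneg_nonneg add_nonneg_nonneg mult_nonneg_nonneg) auto
    finally have "0 \<le> 4 * proj_var / n + 2 * (var - 2 * proj_var) / (real n * (real n - 1))" .
    moreover have "0 \<le> var / M" using proj_var_nonneg proj_var_le_var by simp
    ultimately show ?thesis using mse_t by linarith
  qed
  then have t0: "0 \<le> t" using tau(1) by (simp add: zero_le_mult_iff)
  then have r0: "0 \<le> r" by (simp add: r_def)
  have mse: "4 * proj_var / n + 2 * (var - 2 * proj_var) / (real n * (real n - 1)) + var / M \<le> \<tau> / 3 * r\<^sup>2"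
    using mse_t t0 by (simp add: r_def)
  define bad where "bad x js \<longleftrightarrow> r < norm (incomplete_U M h x js - mean)" for x js
  \<comment> \<open>The failure event lives on the product of the sample law and the block law,
    where Fubini is available; it is pulled back to \<open>P\<close> below.\<close>
  define E where "E = {z \<in> space (PX \<Otimes>\<^sub>M PJ).
    \<alpha> * K \<le> real (card {k\<in>{1..K}. snd z k \<notin> B \<or> bad (fst z) (snd z k)})}"
  have PX: "prob_space PX" unfolding PX_def by (intro prob_space_PiM D.prob_space_axioms)
  have bad_meas: "{x \<in> space PX. bad x js} \<in> sets PX" if "js \<in> B" for js
  proof -
    have [measurable]: "(\<lambda>x. incomplete_U M h x js) \<in> borel_measurable PX"
      unfolding PX_def using that by (intro incomplete_U_measurable vertices_subset) (simp add: B_def)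
    show ?thesis unfolding bad_def by measurable
  qed
  have E_sets: "E \<in> sets (PX \<Otimes>\<^sub>M PJ)"
    unfolding E_def PJ_def by (rule block_votes_measurable[OF B bad_meas])
  have "measure (PX \<Otimes>\<^sub>M PJ) E \<le> measure PX {x \<in> space PX. \<tau> \<le> real (card {js\<in>B. bad x js}) / card B}
      + exp (- 2 * K * (\<alpha> - \<tau>)\<^sup>2)"
    unfolding E_def PJ_def by (rule block_votes_tail[OF PX B pos(2) tau(2) bad_meas])
  also have "measure PX {x \<in> space PX. \<tau> \<le> real (card {js\<in>B. bad x js}) / card B}
      \<le> exp (- 2 * real (n div (2 * M)) * (2 * \<tau> / 3)\<^sup>2)"
    unfolding PX_def B_def bad_def
    by (rule deviation_tail[OF n2 pos(3) bounds(3) _ _ tau(1) r0 mse])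
      (use bounds(4) pos(3) in \<open>simp_all add: div_greater_zero_iff\<close>)
  also have "exp (- 2 * real (n div (2 * M)) * (2 * \<tau> / 3)\<^sup>2) + exp (- 2 * K * (\<alpha> - \<tau>)\<^sup>2) \<le> \<delta> / 2 + \<delta> / 2"
    by (intro add_mono bounds)
  finally have E_le: "measure (PX \<Otimes>\<^sub>M PJ) E \<le> \<delta>" by simp
  let ?XJ = "\<lambda>\<omega>. (Xr \<omega>, Jr \<omega>)"
  have XJ: "?XJ \<in> measurable P (PX \<Otimes>\<^sub>M PJ)"
    using measurable_Pair[OF Xr Jr] by (simp only: law_XJ[symmetric] measurable_distr_eq2)
  \<comment> \<open>\<open>A\<close> is defined by the measurable votes; the bound on the estimator
    then holds pointwise on it.\<close>
  define A where "A = space P - ?XJ -` E \<inter> space P"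
  have EA: "?XJ -` E \<inter> space P \<in> sets P" by (rule measurable_sets[OF XJ E_sets])
  have "measure P (?XJ -` E \<inter> space P) = measure (PX \<Otimes>\<^sub>M PJ) E"
    using measure_distr[OF measurable_Pair[OF Xr Jr], of E] E_sets unfolding law_XJ[symmetric] by simp
  then have "measure P A \<ge> 1 - \<delta>"
    unfolding A_def using E_le EA by (subst P.prob_compl) auto
  moreover have "norm (\<Theta>hat \<omega> - mean) \<le> C\<^sub>\<alpha> * r" if "\<omega> \<in> A" for \<omega>
  proof -
    have \<omega>: "\<omega> \<in> space P" "?XJ \<omega> \<notin> E" using that by (auto simp: A_def)
    then have "real (card {k\<in>{1..K}. Jr \<omega> k \<notin> B \<or> bad (Xr \<omega>) (Jr \<omega> k)}) < \<alpha> * K"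
      using measurable_space[OF XJ] by (auto simp: E_def not_le)
    \<comment> \<open>A block in \<open>B\<close> uses only indices in {1..n}, so restricting the
      sample to them changes nothing, and a \<open>J k\<close> outside \<open>B\<close> is counted
      on the right anyway. The inclusion therefore holds surely, not just almost surely.\<close>
    moreover have "{k\<in>{1..K}. norm (incomplete_U M h (\<lambda>i. X i \<omega>) (J k \<omega>) - mean) > r}
        \<subseteq> {k\<in>{1..K}. Jr \<omega> k \<notin> B \<or> bad (Xr \<omega>) (Jr \<omega> k)}"
    proof (clarify)
      fix k assume k: "k \<in> {1..K}" "r < norm (incomplete_U M h (\<lambda>i. X i \<omega>) (J k \<omega>) - mean)"
        "\<not> bad (Xr \<omega>) (Jr \<omega> k)" "Jr \<omega> k \<in> B"
      have "incomplete_U M h (Xr \<omega>) (J k \<omega>) = incomplete_U M h (\<lambda>i. X i \<omega>) (J k \<omega>)"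
        using vertices_subset[of "J k \<omega>" scheme n M] k
        by (intro incomplete_U_cong) (auto simp: Xr_def Jr_def B_def)
      then show False using k by (simp add: bad_def Jr_def)
    qed
    then have "card {k\<in>{1..K}. norm (incomplete_U M h (\<lambda>i. X i \<omega>) (J k \<omega>) - mean) > r}
        \<le> card {k\<in>{1..K}. Jr \<omega> k \<notin> B \<or> bad (Xr \<omega>) (Jr \<omega> k)}"
      by (intro card_mono) auto
    ultimately have "real (card {k\<in>{1..K}. norm (incomplete_U M h (\<lambda>i. X i \<omega>) (J k \<omega>) - mean) > r}) < \<alpha> * card {1..K}"
      by simp
    moreover have "(\<Sum>k\<in>{1..K}. norm (\<Theta>hat \<omega> - incomplete_U M h (\<lambda>i. X i \<omega>) (J k \<omega>)))
        \<le> (\<Sum>k\<in>{1..K}. norm (w - incomplete_U M h (\<lambda>i. X i \<omega>) (J k \<omega>)))" for w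
      using \<Theta>hat[OF \<omega>(1)] by (auto simp: is_geometric_median_def is_arg_min_def not_less)
    ultimately show ?thesis
      unfolding C_alpha by (intro geometric_median_robust[OF alpha, of "{1..K}"]) auto
  qed
  moreover have "A \<in> sets P" unfolding A_def using EA by auto
  ultimately show ?thesis
    unfolding moments zeta2_sq_def r_def t_def L_def by blast
qed

end
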